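(* Let $q\ge 1$, let $\{N_k\}_{k\ge1}$ be i.i.d. standard normal random variables, let $\alpha_{\infty,1},\dots,\alpha_{\infty,q}$ be non-zero pairwise distinct real numbers and, for each $n\ge1$, let $(\alpha_{n,k})_{k\ge1}$ be a real sequence, with $\sum_{k\ge1}\alpha_{n,k}^2=\sum_{k=1}^q\alpha_{\infty,k}^2=1$. Set $$F_n=\sum_{k\ge1}\alpha_{n,k}(N_k^2-1),\qquad F_\infty=\sum_{k=1}^q\alpha_{\infty,k}(N_k^2-1),$$ elements of the second Wiener chaos. Then there exists a constant $C>0$ depending only on the target $F_\infty$ (hence independent of $n$) such that: (a) $$\mathbf{W}_2(F_n,F_\infty)\le C\left(\sqrt{\Delta(F_n)}+\sum_{r=2}^{q+1}|\kappa_r(F_n)-\kappa_r(F_\infty)|\right).$$ (b) If moreover $\dim_{\mathbb{Q}}\operatorname{span}\{\alpha_{\infty,1}^2,\dots,\alpha_{\infty,q}^2\}=q$, then $\mathbf{W}_2(F_n,F_\infty)\le C\sqrt{\Delta(F_n)}$. In particular, in this case the sole convergence $\Delta(F_n)\to\Delta(F_\infty)=0$ is sufficient for the convergence in distribution of $F_n$ to $F_\infty$.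
   Context: $\kappa_r(X)$ denotes the $r$th cumulant of $X$. The 2-Wasserstein distance is $\mathbf{W}_2(F,G)=(\inf \mathbb{E}|X-Y|^2)^{1/2}$, the infimum being over all couplings $(X,Y)$ with $X\sim F$, $Y\sim G$ in law. Moreover $$\Delta(F_n)=\sum_{k\ge1}\alpha_{n,k}^2\prod_{r=1}^q(\alpha_{n,k}-\alpha_{\infty,r})^2 .$$ The series defining $F_n$ converges in $L^2$ and almost surely. $\dim_{\mathbb Q}\operatorname{span}$ is the dimension of the $\mathbb{Q}$-linear span inside $\mathbb{R}$. *)

theory Defs
  imports "HOL-Probability.Probability"
begin

text \<open>All index sets are shifted to start at 0: the sequences $N_k$, $\alpha_{n,k}$ ($k \ge 1$)
  are functions on \<^typ>\<open>nat\<close>, and $\alpha_{\infty,1},\dots,\alpha_{\infty,q}$ are the values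
  \<open>\<beta> 0, \<dots>, \<beta> (q - 1)\<close> of a function \<open>\<beta>\<close>.\<close>

text \<open>$\kappa_r(\mu) = (-i)^r \frac{d^r}{dt^r} \log \varphi_\mu(t)|_{t=0}$ with $\varphi_\mu$ the
  characteristic function. As $\varphi_\mu(0) = 1$, the principal branch is the right one near 0.
  If the moment of order r is finite, the value is real, so that \<^const>\<open>Re\<close> only changes the type.\<close>

definition cumulant :: "nat \<Rightarrow> real measure \<Rightarrow> real" where
  "cumulant r \<mu> =
     Re ((- \<i>) ^ r * ((\<lambda>f t. vector_derivative f (at t)) ^^ r) (\<lambda>t. Ln (char \<mu> t)) 0)"

text \<open>A coupling is given by the joint law of the pair.\<close>

definition couplings :: "real measure \<Rightarrow> real measure \<Rightarrow> (real \<times> real) measure set" where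
  "couplings \<mu> \<nu> = {\<gamma>. prob_space \<gamma> \<and> sets \<gamma> = sets (borel \<Otimes>\<^sub>M borel) \<and>
     distr \<gamma> borel fst = \<mu> \<and> distr \<gamma> borel snd = \<nu>}"

text \<open>The distance is extended-valued, so that an infinite infimum is not turned into 0 by
  \<^const>\<open>enn2real\<close>.\<close>

definition wasserstein2 :: "real measure \<Rightarrow> real measure \<Rightarrow> ennreal" where
  "wasserstein2 \<mu> \<nu> =
     (let c = (INF \<gamma> \<in> couplings \<mu> \<nu>. \<integral>\<^sup>+ z. ennreal (\<bar>fst z - snd z\<bar>\<^sup>2) \<partial>\<gamma>)
      in if c = \<infinity> then \<infinity> else ennreal (sqrt (enn2real c)))"

text \<open>The element $\sum_k a_k (N_k^2 - 1)$ of the second Wiener chaos, as a pointwise series. For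
  square-summable \<open>a\<close> and i.i.d. standard normal \<open>N\<close> it converges almost surely; on the
  exceptional null set \<^const>\<open>suminf\<close> has an irrelevant fixed value.\<close>

definition chaos2 :: "(nat \<Rightarrow> 'a \<Rightarrow> real) \<Rightarrow> (nat \<Rightarrow> real) \<Rightarrow> 'a \<Rightarrow> real" where
  "chaos2 N a \<omega> = (\<Sum>k. a k * ((N k \<omega>)\<^sup>2 - 1))"

definition chaos2_fin :: "(nat \<Rightarrow> 'a \<Rightarrow> real) \<Rightarrow> nat \<Rightarrow> (nat \<Rightarrow> real) \<Rightarrow> 'a \<Rightarrow> real" where
  "chaos2_fin N q \<beta> \<omega> = (\<Sum>k<q. \<beta> k * ((N k \<omega>)\<^sup>2 - 1))"

text \<open>$\Delta(F)$ for $F$ with coefficient sequence \<open>a\<close>, relative to the target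
  coefficients \<open>\<beta> 0, \<dots>, \<beta> (q - 1)\<close>.\<close>

definition Delta :: "nat \<Rightarrow> (nat \<Rightarrow> real) \<Rightarrow> (nat \<Rightarrow> real) \<Rightarrow> real" where
  "Delta q \<beta> a = (\<Sum>k. (a k)\<^sup>2 * (\<Prod>r<q. (a k - \<beta> r)\<^sup>2))"

text \<open>The coefficient sequence of $F_\infty$ as an infinite sequence.\<close>

definition zero_ext :: "nat \<Rightarrow> (nat \<Rightarrow> real) \<Rightarrow> nat \<Rightarrow> real" where
  "zero_ext q \<beta> k = (if k < q then \<beta> k else 0)"

text \<open>The reals as a vector space over the rationals. Over an infinite-dimensional span,
  \<^const>\<open>vector_space.dim\<close> is 0; here it is applied to spans of finite sets only.\<close>

definition rat_scale :: "rat \<Rightarrow> real \<Rightarrow> real" where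
  "rat_scale c x = of_rat c * x"

lemma vector_space_rat_scale: "vector_space rat_scale"
  by unfold_locales (simp_all add: rat_scale_def algebra_simps of_rat_add of_rat_mult)

definition rat_span_dim :: "real set \<Rightarrow> nat" where
  "rat_span_dim S = vector_space.dim rat_scale (module.span rat_scale S)"

end

theory Submission imports Defs begin

text \<open>
  The proof compares the coefficients $\alpha_{n,k}$ with the points $0, \beta_0, \dots,
  \beta_{q-1}$. The polynomial $x^2 \prod_r (x - \beta_r)^2$, whose values are summed in $\Delta$,
  vanishes exactly there and has double zeros. Hence $\sqrt{\Delta}$ bounds, up to a constant, the
  $\ell^2$-distance between the coefficients and their rounded values (\<open>rounding_distance\<close>).

  If each $\beta_r$ is the rounded value of exactly one coefficient, then the rounded sequence is a
  rearrangement of the target. The second-chaos series with these rearranged coefficients has the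
  law of $F_\infty$ and lives on the same probability space as $F_n$. So it is a coupling, and its
  cost is at most twice the squared $\ell^2$-distance (\<open>wasserstein2_chaos2_le\<close>). Beyond
  such couplings, only the cumulants of $F_n$ enter. They are
  $\kappa_p(F_n) = 2^{p-1} (p-1)! \sum_k \alpha_{n,k}^p$ (\<open>cumulant_chaos2\<close>).

  It remains to exclude other multiplicities $m_r$, or to show that they make the right-hand side
  large. Rounding changes the power sums of order $p \ge 2$ by $O(\sqrt\Delta)$ only
  (\<open>power_sum_error\<close>), so $\sum_r (m_r - 1) \beta_r^p$ is bounded by a multiple of
  $\sqrt\Delta + |\kappa_p(F_n) - \kappa_p(F_\infty)|$. For $p = 2, \dots, q + 1$ the matrix
  $(\beta_r^p)$ is of Vandermonde type and invertible, so one of these sums is non-zero unless all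
  $m_r$ are 1 (\<open>vandermonde_weights_zero\<close>). If the squares $\beta_r^2$ are linearly independent over the
  rationals, then $p = 2$ alone suffices, because the $m_r$ are integers
  (\<open>rational_weights_zero\<close>), and the second cumulants agree by the normalisation. The $m_r$ are
  bounded, since $\sum_k \alpha_{n,k}^2 = 1$, so only finitely many vectors $m$ occur, and the
  right-hand side is bounded away from 0 on the wrong ones (\<open>finite_profile_gap\<close>). There the
  distance is at most $\sqrt 8$ anyway.

  Convergence in distribution follows because the Wasserstein distance controls the difference of
  characteristic functions (\<open>char_diff_le_wasserstein2\<close>).
\<close>

section \<open>Wrong multiplicities are bounded away from the right ones\<close>

text \<open>The vanishing of the \<open>q\<close> power sums says that the weights \<open>m r * (\<beta> r)\<^sup>2\<close> annihilate every
  polynomial of degree less than \<open>q\<close>. The polynomial to test against is the one that vanishes at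
  all nodes but one.\<close>

lemma vandermonde_weights_zero:
  fixes \<beta> m :: "nat \<Rightarrow> real"
  assumes nz: "\<And>r. r < q \<Longrightarrow> \<beta> r \<noteq> 0" and inj: "inj_on \<beta> {..<q}"
    and zero: "\<And>p. p \<in> {2..q+1} \<Longrightarrow> (\<Sum>r<q. m r * \<beta> r ^ p) = 0"
    and s: "s < q"
  shows "m s = 0"
proof -
  define P where "P = (\<Prod>r\<in>{..<q} - {s}. [:- \<beta> r, 1:])"
  have "degree P = (\<Sum>r\<in>{..<q} - {s}. degree [:- \<beta> r, 1:])"
    unfolding P_def by (rule degree_prod_eq_sum_degree) auto
  then have deg: "degree P < q" using s by simp
  have P0: "poly P (\<beta> r) = 0" if "r < q" "r \<noteq> s" for r
    using that unfolding P_def poly_prod by (intro prod_zero) auto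
  have Ps: "poly P (\<beta> s) \<noteq> 0"
    using inj s unfolding P_def poly_prod by (auto simp: inj_on_def)
  have "(\<Sum>r<q. m r * (\<beta> r)\<^sup>2 * poly P (\<beta> r)) = (\<Sum>r<q. \<Sum>i\<le>degree P. coeff P i * (m r * \<beta> r ^ (i + 2)))"
    unfolding poly_altdef sum_distrib_left
    by (intro sum.cong refl) (simp add: power_add power2_eq_square algebra_simps)
  also have "\<dots> = (\<Sum>i\<le>degree P. coeff P i * (\<Sum>r<q. m r * \<beta> r ^ (i + 2)))"
    unfolding sum_distrib_left by (rule sum.swap)
  also have "\<dots> = 0"
    using deg by (intro sum.neutral) (auto simp del: power_add power_Suc add_2_eq_Suc' intro!: zero)
  finally have "(\<Sum>r<q. m r * (\<beta> r)\<^sup>2 * poly P (\<beta> r)) = 0" .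
  moreover have "(\<Sum>r<q. m r * (\<beta> r)\<^sup>2 * poly P (\<beta> r)) = m s * (\<beta> s)\<^sup>2 * poly P (\<beta> s)"
    using s P0 by (subst sum.remove[of _ s]) auto
  ultimately show ?thesis using Ps nz[OF s] by simp
qed

text \<open>The dimension hypothesis carries two facts: the values \<open>f r\<close> are distinct for different
  indices, and they are linearly independent over the rationals. Both come from comparing the
  dimension with the cardinality of a spanning set of at most \<open>q\<close> elements.\<close>

lemma rational_weights_zero:
  assumes dim: "rat_span_dim (f ` {..<q}) = q"
    and zero: "(\<Sum>r<q. real_of_rat (c r) * f r) = 0"
    and s: "s < q"
  shows "c s = 0"
proof -
  interpret Q: vector_space rat_scale by (rule vector_space_rat_scale)
  let ?S = "f ` {..<q}"
  have dimS: "Q.dim ?S = q"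
    using dim unfolding rat_span_dim_def by (simp add: Q.dim_span)
  have "Q.dim ?S \<le> card ?S" by (rule Q.dim_le_card') simp
  moreover have "card ?S \<le> q" using card_image_le[of "{..<q}" f] by simp
  ultimately have card: "card ?S = q" using dimS by simp
  then have inj: "inj_on f {..<q}" by (intro eq_card_imp_inj_on) auto
  obtain B where B: "B \<subseteq> ?S" "Q.independent B" "card B = Q.dim ?S"
    by (rule Q.basis_exists[of ?S])
  then have "B = ?S" using dimS card by (intro card_subset_eq) auto
  then have indep: "Q.independent ?S" using B by simp
  define u where "u v = c (the_inv_into {..<q} f v)" for v
  have "(\<Sum>v\<in>?S. rat_scale (u v) v) = (\<Sum>r<q. real_of_rat (c r) * f r)"
    using inj by (subst sum.reindex) (auto simp: u_def the_inv_into_f_f rat_scale_def)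
  then have "u (f s) = 0"
    using indep zero s by (intro Q.independentD[OF indep, of ?S u]) auto
  then show ?thesis using inj s by (simp add: u_def the_inv_into_f_f)
qed

text \<open>A multiplicity profile assigns to each target coefficient the number of coefficients of
  $F_n$ close to it. Only finitely many profiles are bounded by \<open>B\<close>, so a functional that is
  positive on all wrong profiles is bounded away from 0 on them. This compactness is where a
  constant that does not depend on $n$ comes from.\<close>

lemma finite_profile_gap:
  fixes \<Phi> :: "(nat \<Rightarrow> nat) \<Rightarrow> real"
  assumes cong: "\<And>n n'. (\<And>r. r < q \<Longrightarrow> n r = n' r) \<Longrightarrow> \<Phi> n = \<Phi> n'"
    and pos: "\<And>n. \<exists>r<q. n r \<noteq> 1 \<Longrightarrow> \<Phi> n > 0"
  shows "\<exists>\<eta>>0. \<forall>n. (\<forall>r<q. n r \<le> B) \<longrightarrow> (\<exists>r<q. n r \<noteq> 1) \<longrightarrow> \<eta> \<le> \<Phi> n"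
proof -
  define V where "V = {n \<in> {..<q} \<rightarrow>\<^sub>E {..B}. \<exists>r<q. n r \<noteq> 1}"
  have fin: "finite V" unfolding V_def by (intro finite_subset[OF _ finite_PiE[of "{..<q}" "\<lambda>_. {..B}"]]) auto
  define \<eta> where "\<eta> = Min (insert 1 (\<Phi> ` V))"
  have "\<eta> > 0" unfolding \<eta>_def using fin pos by (auto simp: V_def)
  moreover have "\<eta> \<le> \<Phi> n" if n: "\<forall>r<q. n r \<le> B" "\<exists>r<q. n r \<noteq> 1" for n
  proof -
    \<comment> \<open>Profiles matter only below \<open>q\<close>; restriction picks one representative of each class.\<close>
    have "restrict n {..<q} \<in> V" using n by (auto simp: V_def)
    then have "\<eta> \<le> \<Phi> (restrict n {..<q})" unfolding \<eta>_def using fin by (intro Min_le) auto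
    also have "\<dots> = \<Phi> n" by (rule cong) auto
    finally show ?thesis .
  qed
  ultimately show ?thesis by blast
qed

section \<open>Rounding coefficients to the target\<close>

lemma separation_exists:
  fixes \<beta> :: "nat \<Rightarrow> real"
  assumes nz: "\<And>r. r < q \<Longrightarrow> \<beta> r \<noteq> 0" and inj: "inj_on \<beta> {..<q}"
  obtains d where "d > 0" "\<And>r. r < q \<Longrightarrow> d \<le> \<bar>\<beta> r\<bar>"
    "\<And>r s. r < q \<Longrightarrow> s < q \<Longrightarrow> r \<noteq> s \<Longrightarrow> d \<le> \<bar>\<beta> r - \<beta> s\<bar>"
proof -
  define A where "A = (\<lambda>r. \<bar>\<beta> r\<bar>) ` {..<q} \<union> (\<lambda>(r, s). \<bar>\<beta> r - \<beta> s\<bar>) ` {x \<in> {..<q} \<times> {..<q}. fst x \<noteq> snd x}"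
  have fin: "finite A" unfolding A_def by auto
  have pos: "Min (insert 1 A) > 0"
    using fin nz inj by (auto simp: A_def inj_on_def)
  have "Min (insert 1 A) \<le> \<bar>\<beta> r\<bar>" if "r < q" for r
    using that fin by (intro Min_le) (auto simp: A_def)
  moreover have "Min (insert 1 A) \<le> \<bar>\<beta> r - \<beta> s\<bar>" if "r < q" "s < q" "r \<noteq> s" for r s
    using that fin by (intro Min_le) (auto simp: A_def intro!: image_eqI[of _ _ "(r, s)"])
  ultimately show ?thesis using pos that by blast
qed

text \<open>For exponents at least 2 one factor of size $|x| + |y|$ remains. It makes the error of a power
  sum amenable to the Cauchy--Schwarz inequality, even for infinitely many coefficients.\<close>

lemma abs_power_diff_le:
  fixes x y :: real
  assumes x: "\<bar>x\<bar> \<le> 1" and y: "\<bar>y\<bar> \<le> 1" and p: "p \<ge> 2"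
  shows "\<bar>x ^ p - y ^ p\<bar> \<le> real p * (\<bar>x - y\<bar> * (\<bar>x\<bar> + \<bar>y\<bar>))"
  using p
proof (induction p rule: dec_induct)
  case base
  have "x\<^sup>2 - y\<^sup>2 = (x - y) * (x + y)" by (simp add: algebra_simps power2_eq_square)
  then have "\<bar>x\<^sup>2 - y\<^sup>2\<bar> = \<bar>x - y\<bar> * \<bar>x + y\<bar>" by (simp add: abs_mult)
  also have "\<dots> \<le> \<bar>x - y\<bar> * (\<bar>x\<bar> + \<bar>y\<bar>)" by (intro mult_left_mono) auto
  also have "\<dots> \<le> 2 * (\<bar>x - y\<bar> * (\<bar>x\<bar> + \<bar>y\<bar>))" by simp
  finally show ?case by simp
next
  case (step p)
  have "x ^ Suc p - y ^ Suc p = x * (x ^ p - y ^ p) + (x - y) * y ^ p" by (simp add: algebra_simps)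
  then have "\<bar>x ^ Suc p - y ^ Suc p\<bar> \<le> \<bar>x\<bar> * \<bar>x ^ p - y ^ p\<bar> + \<bar>x - y\<bar> * \<bar>y\<bar> ^ p"
    by (metis abs_mult abs_triangle_ineq power_abs)
  also have "\<bar>x\<bar> * \<bar>x ^ p - y ^ p\<bar> \<le> 1 * \<bar>x ^ p - y ^ p\<bar>" using x by (intro mult_right_mono) auto
  also have "\<bar>y\<bar> ^ p \<le> \<bar>x\<bar> + \<bar>y\<bar>"
    using power_decreasing[of 1 p "\<bar>y\<bar>"] y step by (auto intro: order_trans)
  finally have "\<bar>x ^ Suc p - y ^ Suc p\<bar> \<le> real p * (\<bar>x - y\<bar> * (\<bar>x\<bar> + \<bar>y\<bar>)) + \<bar>x - y\<bar> * (\<bar>x\<bar> + \<bar>y\<bar>)"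
    using step.IH by (simp add: mult_left_mono)
  then show ?case by (simp add: distrib_right)
qed

lemma sq_sums_1_abs_le:
  fixes a :: "nat \<Rightarrow> real"
  assumes "(\<lambda>k. (a k)\<^sup>2) sums 1"
  shows "\<bar>a k\<bar> \<le> 1"
proof -
  have "(\<Sum>j\<in>{k}. (a j)\<^sup>2) \<le> (\<Sum>j. (a j)\<^sup>2)"
    using assms by (intro sum_le_suminf) (auto simp: sums_iff)
  then show ?thesis using assms by (simp add: sums_iff abs_square_le_1)
qed

text \<open>The coefficient sequence of $F_\infty$ with its entries moved to the positions \<open>\<sigma> 0\<close>, \dots,
  \<open>\<sigma> (q - 1)\<close>.\<close>

definition placed :: "nat \<Rightarrow> (nat \<Rightarrow> real) \<Rightarrow> (nat \<Rightarrow> nat) \<Rightarrow> nat \<Rightarrow> real" where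
  "placed q \<beta> \<sigma> k = (\<Sum>r<q. of_bool (k = \<sigma> r) * \<beta> r)"

text \<open>The number \<open>d\<close> separates the points $0, \beta_0, \dots, \beta_{q-1}$. The open intervals of
  radius \<open>d / 2\<close> around the \<open>\<beta> r\<close> are then disjoint, and \<open>0\<close> is at distance at least \<open>d / 2\<close> from
  each of them.\<close>

locale separated_target =
  fixes q :: nat and \<beta> :: "nat \<Rightarrow> real" and d :: real
  assumes d_pos: "d > 0"
    and d_le_abs: "r < q \<Longrightarrow> d \<le> \<bar>\<beta> r\<bar>"
    and d_le_dist: "r < q \<Longrightarrow> s < q \<Longrightarrow> r \<noteq> s \<Longrightarrow> d \<le> \<bar>\<beta> r - \<beta> s\<bar>"
    and sum_sq: "(\<Sum>r<q. (\<beta> r)\<^sup>2) = 1"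
begin

lemma \<beta>_abs_le: "r < q \<Longrightarrow> \<bar>\<beta> r\<bar> \<le> 1"
  using member_le_sum[of r "{..<q}" "\<lambda>r. (\<beta> r)\<^sup>2"] sum_sq by (simp add: abs_square_le_1)

definition near :: "nat \<Rightarrow> real \<Rightarrow> bool" where
  "near r x \<longleftrightarrow> \<bar>x - \<beta> r\<bar> < d / 2"

text \<open>At most one summand is non-zero, so this is the target coefficient close to \<open>x\<close> if there is one
  and 0 otherwise. The form as a sum makes power sums of rounded sequences immediate.\<close>

definition rounded :: "real \<Rightarrow> real" where
  "rounded x = (\<Sum>r<q. of_bool (near r x) * \<beta> r)"

lemma near_unique: "r < q \<Longrightarrow> s < q \<Longrightarrow> near r x \<Longrightarrow> near s x \<Longrightarrow> r = s"
  using d_le_dist[of r s] unfolding near_def by (smt (verit) field_sum_of_halves)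

lemma rounded_power:
  assumes "p \<ge> 1"
  shows "rounded x ^ p = (\<Sum>r<q. of_bool (near r x) * \<beta> r ^ p)"
proof (cases "\<exists>r<q. near r x")
  case True
  then obtain r where r: "r < q" "near r x" by blast
  have *: "(\<Sum>s<q. of_bool (near s x) * g s) = g r" for g :: "nat \<Rightarrow> real"
    using r near_unique by (subst sum.remove[of _ r]) (auto intro!: sum.neutral)
  show ?thesis unfolding rounded_def * ..
next
  case False
  then show ?thesis using assms by (simp add: rounded_def)
qed

lemma rounded_near: "r < q \<Longrightarrow> near r x \<Longrightarrow> rounded x = \<beta> r"
  unfolding rounded_def using near_unique by (subst sum.remove[of _ r]) (auto intro!: sum.neutral)

lemma rounded_far: "(\<And>r. r < q \<Longrightarrow> \<not> near r x) \<Longrightarrow> rounded x = 0"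
  by (simp add: rounded_def)

lemma near_imp_half_le: 
  assumes "r < q" "near r x"
  shows "\<bar>\<beta> r\<bar> / 2 \<le> \<bar>x\<bar>" "d / 2 \<le> \<bar>x\<bar>"
  using d_le_abs[OF assms(1)] assms(2) unfolding near_def by linarith+

lemma abs_rounded_le: "\<bar>rounded x\<bar> \<le> 2 * \<bar>x\<bar>"
proof (cases "\<exists>r<q. near r x")
  case True
  then obtain r where "r < q" "near r x" by blast
  then show ?thesis using near_imp_half_le(1)[of r x] rounded_near[of r x] by simp
qed (use rounded_far[of x] in auto)

lemma abs_rounded_le_1: "\<bar>rounded x\<bar> \<le> 1"
proof (cases "\<exists>r<q. near r x")
  case True
  then obtain r where "r < q" "near r x" by blast
  then show ?thesis using \<beta>_abs_le[of r] rounded_near[of r x] by simp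
qed (use rounded_far[of x] in auto)

text \<open>The factors of $x^2 \prod_r (x - \beta_r)^2$ vanish exactly at $0, \beta_0, \dots,
  \beta_{q-1}$. One of the $q + 1$ factors is the squared rounding error, and each of the others is
  at least $(d/2)^2$.\<close>

lemma rounding_error:
  "(d / 2) ^ (2 * q) * (x - rounded x)\<^sup>2 \<le> x\<^sup>2 * (\<Prod>r<q. (x - \<beta> r)\<^sup>2)"
proof (cases "\<exists>r<q. near r x")
  case True
  then obtain r where r: "r < q" "near r x" by blast
  have far: "d / 2 \<le> \<bar>x - \<beta> s\<bar>" if "s < q" "s \<noteq> r" for s
    using d_le_dist[of r s] that r unfolding near_def by linarith
  have "(\<Prod>s\<in>{..<q} - {r}. (d / 2)\<^sup>2) \<le> (\<Prod>s\<in>{..<q} - {r}. (x - \<beta> s)\<^sup>2)"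
    using far d_pos by (intro prod_mono) (auto simp: abs_le_square_iff[symmetric])
  moreover have "(d / 2)\<^sup>2 \<le> x\<^sup>2"
    using near_imp_half_le(2)[OF r] d_pos by (auto simp: abs_le_square_iff[symmetric])
  ultimately have "(d / 2)\<^sup>2 * (\<Prod>s\<in>{..<q} - {r}. (d / 2)\<^sup>2) \<le> x\<^sup>2 * (\<Prod>s\<in>{..<q} - {r}. (x - \<beta> s)\<^sup>2)"
    by (intro mult_mono) (auto intro!: prod_nonneg)
  moreover have "(d / 2)\<^sup>2 * (\<Prod>s\<in>{..<q} - {r}. (d / 2)\<^sup>2) = (\<Prod>s<q. (d / 2)\<^sup>2)"
    using r by (subst (2) prod.remove[of _ r]) auto
  moreover have "(\<Prod>s<q. (d / 2)\<^sup>2) = (d / 2) ^ (2 * q)" by (simp add: power_mult)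
  ultimately have "(d / 2) ^ (2 * q) * (x - \<beta> r)\<^sup>2 \<le> x\<^sup>2 * (\<Prod>s\<in>{..<q} - {r}. (x - \<beta> s)\<^sup>2) * (x - \<beta> r)\<^sup>2"
    by (intro mult_right_mono) auto
  also have "\<dots> = x\<^sup>2 * (\<Prod>s<q. (x - \<beta> s)\<^sup>2)"
    using r by (subst (2) prod.remove[of _ r]) auto
  finally show ?thesis using rounded_near[OF r] by simp
next
  case False
  then have "d / 2 \<le> \<bar>x - \<beta> s\<bar>" if "s < q" for s
    using that unfolding near_def by (meson not_less)
  then have "(\<Prod>s<q. (d / 2)\<^sup>2) \<le> (\<Prod>s<q. (x - \<beta> s)\<^sup>2)"
    using d_pos by (intro prod_mono) (auto simp: abs_le_square_iff[symmetric])
  then have "(d / 2) ^ (2 * q) * x\<^sup>2 \<le> (\<Prod>s<q. (x - \<beta> s)\<^sup>2) * x\<^sup>2"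
    by (intro mult_right_mono) (auto simp: power_mult)
  then show ?thesis using rounded_far[of x] False by (simp add: mult.commute)
qed

lemma summable_Delta:
  assumes a: "(\<lambda>k. (a k)\<^sup>2) sums 1"
  shows "summable (\<lambda>k. (a k)\<^sup>2 * (\<Prod>r<q. (a k - \<beta> r)\<^sup>2))"
proof (rule summable_comparison_test)
  have "(a k - \<beta> r)\<^sup>2 \<le> 2\<^sup>2" if "r < q" for k r
    using sq_sums_1_abs_le[OF a, of k] \<beta>_abs_le[OF that] by (subst abs_le_square_iff[symmetric]) auto
  then have "(\<Prod>r<q. (a k - \<beta> r)\<^sup>2) \<le> (\<Prod>r<q. 2\<^sup>2)" for k
    by (intro prod_mono) auto
  then have "(a k)\<^sup>2 * (\<Prod>r<q. (a k - \<beta> r)\<^sup>2) \<le> (a k)\<^sup>2 * 4 ^ q" for k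
    by (intro mult_left_mono) auto
  then show "\<exists>n. \<forall>k\<ge>n. norm ((a k)\<^sup>2 * (\<Prod>r<q. (a k - \<beta> r)\<^sup>2)) \<le> (a k)\<^sup>2 * 4 ^ q"
    by (auto simp: abs_mult prod_nonneg)
  show "summable (\<lambda>k. (a k)\<^sup>2 * 4 ^ q)" using a by (intro summable_mult2) (auto simp: sums_iff)
qed

lemma Delta_nonneg: "(\<lambda>k. (a k)\<^sup>2) sums 1 \<Longrightarrow> Delta q \<beta> a \<ge> 0"
  unfolding Delta_def by (intro suminf_nonneg summable_Delta) (auto intro!: mult_nonneg_nonneg prod_nonneg)

text \<open>Summed over the coefficients, the pointwise error shows that $\Delta$ controls the
  $\ell^2$-distance to a sequence with values in $\{0, \beta_0, \dots, \beta_{q-1}\}$, but not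
  how often each value is taken.\<close>

lemma rounding_distance:
  assumes a: "(\<lambda>k. (a k)\<^sup>2) sums 1"
  shows "summable (\<lambda>k. (a k - rounded (a k))\<^sup>2)"
    and "(\<Sum>k. (a k - rounded (a k))\<^sup>2) \<le> (2 / d) ^ (2 * q) * Delta q \<beta> a"
proof -
  have le: "(a k - rounded (a k))\<^sup>2 \<le> (2 / d) ^ (2 * q) * ((a k)\<^sup>2 * (\<Prod>r<q. (a k - \<beta> r)\<^sup>2))" for k
    using rounding_error[of "a k"] d_pos by (simp add: field_simps)
  show sm: "summable (\<lambda>k. (a k - rounded (a k))\<^sup>2)"
    by (rule summable_comparison_test[OF _ summable_mult[OF summable_Delta[OF a]]]) (use le in auto)
  show "(\<Sum>k. (a k - rounded (a k))\<^sup>2) \<le> (2 / d) ^ (2 * q) * Delta q \<beta> a"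
    unfolding Delta_def using le
    by (subst suminf_mult[symmetric]) (auto intro!: suminf_le sm summable_mult summable_Delta a)
qed

definition multiplicity_near :: "(nat \<Rightarrow> real) \<Rightarrow> nat \<Rightarrow> nat" where
  "multiplicity_near a r = card {k. near r (a k)}"

text \<open>Each coefficient close to \<open>\<beta> r\<close> contributes at least $(d/2)^2$ to a sum of squares that
  equals 1.\<close>

lemma card_near_le:
  assumes a: "(\<lambda>k. (a k)\<^sup>2) sums 1" and r: "r < q" and A: "finite A" "A \<subseteq> {k. near r (a k)}"
  shows "card A \<le> nat \<lfloor>(2 / d)\<^sup>2\<rfloor>"
proof -
  have "(\<Sum>k\<in>A. (d / 2)\<^sup>2) \<le> (\<Sum>k\<in>A. (a k)\<^sup>2)"
    using A near_imp_half_le(2)[OF r] d_pos by (intro sum_mono) (auto simp: abs_le_square_iff[symmetric])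
  also have "\<dots> \<le> (\<Sum>k. (a k)\<^sup>2)" using a A by (intro sum_le_suminf) (auto simp: sums_iff)
  also have "\<dots> = 1" using a by (simp add: sums_iff)
  finally have "real (card A) \<le> (2 / d)\<^sup>2" using d_pos by (simp add: field_simps power2_eq_square)
  then show ?thesis by (simp add: le_nat_floor)
qed

lemma finite_near: "(\<lambda>k. (a k)\<^sup>2) sums 1 \<Longrightarrow> r < q \<Longrightarrow> finite {k. near r (a k)}"
  using card_near_le[of a r] infinite_arbitrarily_large[of "{k. near r (a k)}" "Suc (nat \<lfloor>(2 / d)\<^sup>2\<rfloor>)"]
  by (metis not_less_eq_eq order_refl)

lemma multiplicity_near_le:
  "(\<lambda>k. (a k)\<^sup>2) sums 1 \<Longrightarrow> r < q \<Longrightarrow> multiplicity_near a r \<le> nat \<lfloor>(2 / d)\<^sup>2\<rfloor>"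
  unfolding multiplicity_near_def by (rule card_near_le) (auto simp: finite_near)

lemma rounded_power_sums:
  assumes a: "(\<lambda>k. (a k)\<^sup>2) sums 1" and p: "p \<ge> 1"
  shows "(\<lambda>k. rounded (a k) ^ p) sums (\<Sum>r<q. multiplicity_near a r * \<beta> r ^ p)"
  unfolding rounded_power[OF p]
proof (intro sums_sum)
  fix r assume "r \<in> {..<q}"
  then have fin: "finite {k. near r (a k)}" using finite_near[OF a] by simp
  have "(\<lambda>k. if k \<in> {k. near r (a k)} then \<beta> r ^ p else 0) sums (\<Sum>k | near r (a k). \<beta> r ^ p)"
    by (rule sums_If_finite_set[OF fin])
  then show "(\<lambda>k. of_bool (near r (a k)) * \<beta> r ^ p) sums (multiplicity_near a r * \<beta> r ^ p)"
    by (simp add: multiplicity_near_def of_bool_def if_distrib[of "\<lambda>x. x * _"] cong: if_cong)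
qed

text \<open>The power sums of the coefficients therefore determine, up to the order $\sqrt\Delta$, those of
  the rounded sequence, which depend only on the multiplicities. The constant 3 bounds
  $|x| + |\mathrm{rounded}(x)|$ in terms of $|x|$.\<close>

lemma power_sum_error:
  assumes a: "(\<lambda>k. (a k)\<^sup>2) sums 1" and p: "p \<ge> 2"
  shows "summable (\<lambda>k. a k ^ p)"
    and "\<bar>(\<Sum>k. a k ^ p) - (\<Sum>r<q. multiplicity_near a r * \<beta> r ^ p)\<bar> \<le> 3 * real p * (2 / d) ^ q * sqrt (Delta q \<beta> a)"
proof -
  have a1: "\<bar>a k\<bar> \<le> 1" for k by (rule sq_sums_1_abs_le[OF a])
  show sm: "summable (\<lambda>k. a k ^ p)"
  proof (rule summable_comparison_test)
    have "\<bar>a k ^ p\<bar> \<le> (a k)\<^sup>2" for k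
      using power_decreasing[OF p, of "\<bar>a k\<bar>"] a1 by (simp add: power_abs)
    then show "\<exists>n. \<forall>k\<ge>n. norm (a k ^ p) \<le> (a k)\<^sup>2" by auto
  qed (use a in \<open>auto simp: sums_iff\<close>)
  let ?b = "\<lambda>k. rounded (a k)"
  have "(\<lambda>n. \<bar>\<Sum>k<n. a k ^ p - ?b k ^ p\<bar>) \<longlonglongrightarrow> \<bar>(\<Sum>k. a k ^ p) - (\<Sum>r<q. multiplicity_near a r * \<beta> r ^ p)\<bar>"
    using p by (intro tendsto_rabs sums_diff[OF summable_sums[OF sm] rounded_power_sums[OF a], unfolded sums_def]) auto
  moreover have "\<bar>\<Sum>k<n. a k ^ p - ?b k ^ p\<bar> \<le> 3 * real p * (2 / d) ^ q * sqrt (Delta q \<beta> a)" for n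
  proof -
    have "\<bar>\<Sum>k<n. a k ^ p - ?b k ^ p\<bar> \<le> (\<Sum>k<n. \<bar>a k ^ p - ?b k ^ p\<bar>)" by (rule sum_abs)
    also have "\<dots> \<le> (\<Sum>k<n. 3 * real p * (\<bar>a k - ?b k\<bar> * \<bar>a k\<bar>))"
    proof (rule sum_mono)
      fix k
      have "\<bar>a k ^ p - ?b k ^ p\<bar> \<le> real p * (\<bar>a k - ?b k\<bar> * (\<bar>a k\<bar> + \<bar>?b k\<bar>))"
        by (intro abs_power_diff_le a1 abs_rounded_le_1 p)
      also have "\<dots> \<le> real p * (\<bar>a k - ?b k\<bar> * (3 * \<bar>a k\<bar>))"
        using abs_rounded_le[of "a k"] by (intro mult_left_mono) auto
      finally show "\<bar>a k ^ p - ?b k ^ p\<bar> \<le> 3 * real p * (\<bar>a k - ?b k\<bar> * \<bar>a k\<bar>)" by simp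
    qed
    also have "\<dots> = 3 * real p * (\<Sum>k<n. \<bar>a k - ?b k\<bar> * \<bar>a k\<bar>)" by (simp add: sum_distrib_left)
    also have "\<dots> \<le> 3 * real p * (L2_set (\<lambda>k. a k - ?b k) {..<n} * L2_set a {..<n})"
      by (intro mult_left_mono L2_set_mult_ineq) auto
    also have "\<dots> \<le> 3 * real p * (((2 / d) ^ q * sqrt (Delta q \<beta> a)) * 1)"
    proof (intro mult_left_mono mult_mono)
      have "L2_set (\<lambda>k. a k - ?b k) {..<n} \<le> sqrt ((2 / d) ^ (2 * q) * Delta q \<beta> a)"
        unfolding L2_set_def
        by (intro real_sqrt_le_mono order_trans[OF sum_le_suminf rounding_distance(2)[OF a]]
              rounding_distance(1)[OF a]) auto
      also have "\<dots> = (2 / d) ^ q * sqrt (Delta q \<beta> a)"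
        using d_pos by (simp add: real_sqrt_mult power_even_eq)
      finally show "L2_set (\<lambda>k. a k - ?b k) {..<n} \<le> (2 / d) ^ q * sqrt (Delta q \<beta> a)" .
      have "(\<Sum>k<n. (a k)\<^sup>2) \<le> (\<Sum>k. (a k)\<^sup>2)" using a by (intro sum_le_suminf) (auto simp: sums_iff)
      then show "L2_set a {..<n} \<le> 1" using a by (simp add: L2_set_def sums_iff)
      show "0 \<le> (2 / d) ^ q * sqrt (Delta q \<beta> a)" using d_pos Delta_nonneg[OF a] by simp
    qed (auto intro: L2_set_nonneg)
    finally show ?thesis by (simp add: mult.assoc)
  qed
  ultimately show "\<bar>(\<Sum>k. a k ^ p) - (\<Sum>r<q. multiplicity_near a r * \<beta> r ^ p)\<bar> \<le> 3 * real p * (2 / d) ^ q * sqrt (Delta q \<beta> a)"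
    by (intro LIMSEQ_le_const2[OF _ exI[of _ 0]]) auto
qed

lemma rounded_eq_placed:
  assumes one: "\<And>r. r < q \<Longrightarrow> multiplicity_near a r = 1"
  obtains \<sigma> where "inj_on \<sigma> {..<q}" "(\<lambda>k. rounded (a k)) = placed q \<beta> \<sigma>"
proof -
  have "\<forall>r\<in>{..<q}. \<exists>k. {j. near r (a j)} = {k}"
    using one by (auto simp: multiplicity_near_def card_1_singleton_iff)
  then obtain \<sigma> where \<sigma>: "\<forall>r\<in>{..<q}. {j. near r (a j)} = {\<sigma> r}" by (rule bchoice[THEN exE])
  have n: "near r (a j) \<longleftrightarrow> j = \<sigma> r" if "r < q" for r j using \<sigma> that by blast
  have "inj_on \<sigma> {..<q}" by (rule inj_onI) (metis n near_unique lessThan_iff)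
  moreover have "(\<lambda>k. rounded (a k)) = placed q \<beta> \<sigma>"
    by (auto simp: rounded_def placed_def n fun_eq_iff)
  ultimately show ?thesis using that by blast
qed

end

section \<open>Series of independent random variables\<close>

text \<open>An $L^2$ limit of the partial sums would not suffice for a random variable defined by a
  pointwise series: almost sure convergence is needed, hence Kolmogorov's maximal inequality.\<close>

locale centered_indep = prob_space +
  fixes Y :: "nat \<Rightarrow> 'a \<Rightarrow> real"
  assumes indep: "indep_vars (\<lambda>_. borel) Y UNIV"
    and square_integrable: "integrable M (\<lambda>\<omega>. (Y k \<omega>)\<^sup>2)"
    and centered: "expectation (Y k) = 0"
begin

lemma measurable_Y [measurable]: "Y k \<in> borel_measurable M"
  using indep unfolding indep_vars_def by auto

lemma integrable_Y: "integrable M (Y k)"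
  using square_integrable by (rule square_integrable_imp_integrable[rotated]) simp

definition past :: "nat \<Rightarrow> 'a \<Rightarrow> nat \<Rightarrow> real" where
  "past n \<omega> = (\<lambda>j\<in>{..<n}. Y j \<omega>)"

lemma past_measurable [measurable]: "past n \<in> measurable M (PiM {..<n} (\<lambda>_. borel))"
  unfolding past_def by measurable

text \<open>The martingale transform of the partial sums. The weight \<open>G j\<close> of the \<open>j\<close>-th increment sees only
  the increments before it.\<close>

definition transform :: "(nat \<Rightarrow> (nat \<Rightarrow> real) \<Rightarrow> real) \<Rightarrow> nat \<Rightarrow> 'a \<Rightarrow> real" where
  "transform G n \<omega> = (\<Sum>j<n. G j (past j \<omega>) * Y j \<omega>)"

text \<open>Increments are orthogonal to everything that depends on their past, so second moments add up,
  and weights of modulus at most 1 do not increase them.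
  Constant weights bound the variance of the partial sums; indicator weights stop the walk.\<close>

lemma transform_second_moment:
  assumes [measurable]: "\<And>j. G j \<in> borel_measurable (PiM {..<j} (\<lambda>_. borel))"
    and bound: "\<And>j y. \<bar>G j y\<bar> \<le> 1"
  shows "integrable M (\<lambda>\<omega>. (transform G n \<omega>)\<^sup>2) \<and>
    expectation (\<lambda>\<omega>. (transform G n \<omega>)\<^sup>2) \<le> (\<Sum>j<n. expectation (\<lambda>\<omega>. (Y j \<omega>)\<^sup>2))"
proof (induction n)
  case 0
  show ?case by (simp add: transform_def)
next
  case (Suc n)
  have [measurable]: "transform G k \<in> borel_measurable M" for k
    unfolding transform_def by measurable
  define g where "g \<omega> = G n (past n \<omega>)" for \<omega>
  have [measurable]: "g \<in> borel_measurable M" unfolding g_def by measurable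
  have g1: "\<bar>g \<omega>\<bar> \<le> 1" for \<omega> unfolding g_def by (rule bound)
  have intT: "integrable M (transform G n)"
    by (rule square_integrable_imp_integrable) (use Suc in simp_all)
  have intTg: "integrable M (\<lambda>\<omega>. transform G n \<omega> * g \<omega>)"
    using g1 by (intro Bochner_Integration.integrable_bound[OF intT]) (auto simp: abs_mult intro!: AE_I2 mult_left_le)
  \<comment> \<open>The transform times the next weight, as a function of the past: this exhibits its independence
    of the next increment.\<close>
  define h where "h y = (\<Sum>j<n. G j (restrict y {..<j}) * y j) * G n y" for y
  have [measurable]: "(\<lambda>y. restrict y {..<j}) \<in> measurable (PiM {..<n} (\<lambda>_. borel)) (PiM {..<j} (\<lambda>_. borel :: real measure))"
    if "j < n" for j using that by (intro measurable_restrict_subset) auto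
  have [measurable]: "h \<in> borel_measurable (PiM {..<n} (\<lambda>_. borel))"
    unfolding h_def by measurable
  have hp: "h (past n \<omega>) = transform G n \<omega> * g \<omega>" for \<omega>
  proof -
    have "restrict (past n \<omega>) {..<j} = past j \<omega>" if "j < n" for j
      using that by (auto simp: past_def)
    then show ?thesis by (simp add: h_def transform_def g_def past_def)
  qed
  have "indep_var (PiM {..<n} (\<lambda>_. borel)) (\<lambda>\<omega>. restrict (\<lambda>i. Y i \<omega>) {..<n}) (PiM {n} (\<lambda>_. borel)) (\<lambda>\<omega>. restrict (\<lambda>i. Y i \<omega>) {n})"
    by (rule indep_var_restrict[OF indep]) auto
  then have "indep_var borel (h \<circ> (\<lambda>\<omega>. restrict (\<lambda>i. Y i \<omega>) {..<n})) borel ((\<lambda>y. y n) \<circ> (\<lambda>\<omega>. restrict (\<lambda>i. Y i \<omega>) {n}))"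
    by (rule indep_var_compose) auto
  then have ind: "indep_var borel (\<lambda>\<omega>. transform G n \<omega> * g \<omega>) borel (Y n)"
    by (simp add: comp_def hp[unfolded past_def])
  have cross: "integrable M (\<lambda>\<omega>. (transform G n \<omega> * g \<omega>) * Y n \<omega>)"
      "expectation (\<lambda>\<omega>. (transform G n \<omega> * g \<omega>) * Y n \<omega>) = 0"
    using indep_var_integrable[OF ind intTg integrable_Y] indep_var_lebesgue_integral[OF ind intTg integrable_Y]
    by (auto simp: centered)
  have g2: "(g \<omega> * Y n \<omega>)\<^sup>2 \<le> (Y n \<omega>)\<^sup>2" for \<omega>
    using g1[of \<omega>] by (simp add: power_mult_distrib mult_left_le_one_le abs_square_le_1)
  have intg: "integrable M (\<lambda>\<omega>. (g \<omega> * Y n \<omega>)\<^sup>2)"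
    using g2 by (intro Bochner_Integration.integrable_bound[OF square_integrable[of n]]) auto
  have eq: "(transform G (Suc n) \<omega>)\<^sup>2 = (transform G n \<omega>)\<^sup>2 + 2 * ((transform G n \<omega> * g \<omega>) * Y n \<omega>) + (g \<omega> * Y n \<omega>)\<^sup>2" for \<omega>
    unfolding transform_def g_def by (simp add: power2_sum algebra_simps)
  have "integrable M (\<lambda>\<omega>. (transform G (Suc n) \<omega>)\<^sup>2)"
    unfolding eq using Suc cross intg by auto
  moreover have "expectation (\<lambda>\<omega>. (transform G (Suc n) \<omega>)\<^sup>2) = expectation (\<lambda>\<omega>. (transform G n \<omega>)\<^sup>2) + expectation (\<lambda>\<omega>. (g \<omega> * Y n \<omega>)\<^sup>2)"
    unfolding eq using Suc cross intg by simp
  moreover have "expectation (\<lambda>\<omega>. (g \<omega> * Y n \<omega>)\<^sup>2) \<le> expectation (\<lambda>\<omega>. (Y n \<omega>)\<^sup>2)"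
    by (intro integral_mono intg square_integrable g2)
  ultimately show ?case using Suc by simp
qed

text \<open>The walk is stopped as soon as it leaves the interval $(-\varepsilon, \varepsilon)$. If it ever
  leaves, the stopped walk ends outside, so Markov's inequality for the square of the stopped walk
  gives the bound.\<close>

lemma kolmogorov_maximal_inequality:
  assumes \<epsilon>: "\<epsilon> > 0"
  shows "prob {\<omega>\<in>space M. \<exists>k\<le>n. \<epsilon> \<le> \<bar>\<Sum>j<k. Y j \<omega>\<bar>} \<le> (\<Sum>j<n. expectation (\<lambda>\<omega>. (Y j \<omega>)\<^sup>2)) / \<epsilon>\<^sup>2"
proof -
  define G :: "nat \<Rightarrow> (nat \<Rightarrow> real) \<Rightarrow> real" where
    "G j y = (if \<forall>i\<in>{..j}. \<bar>\<Sum>l<i. y l\<bar> < \<epsilon> then 1 else 0)" for j y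
  have [measurable]: "(\<lambda>y. \<bar>\<Sum>l<i. y l\<bar>) \<in> borel_measurable (PiM {..<j} (\<lambda>_. borel :: real measure))" if "i \<le> j" for i j :: nat
    using that by (intro borel_measurable_abs borel_measurable_sum measurable_component_singleton) auto
  have [measurable]: "G j \<in> borel_measurable (PiM {..<j} (\<lambda>_. borel))" for j
  proof -
    have "{y \<in> space (PiM {..<j} (\<lambda>_. borel :: real measure)). \<forall>i\<in>{..j}. \<bar>\<Sum>l<i. y l\<bar> < \<epsilon>} \<in> sets (PiM {..<j} (\<lambda>_. borel))"
      by (intro sets.sets_Collect_finite_All borel_measurable_less) auto
    then show ?thesis unfolding G_def by (intro measurable_If) auto
  qed
  have GY: "G j (past j \<omega>) = (if \<forall>i\<le>j. \<bar>\<Sum>l<i. Y l \<omega>\<bar> < \<epsilon> then 1 else 0)" for j \<omega>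
    unfolding G_def past_def by (auto intro!: if_cong)
  have stopped: "\<epsilon> \<le> \<bar>transform G n \<omega>\<bar>" if "\<exists>k\<le>n. \<epsilon> \<le> \<bar>\<Sum>j<k. Y j \<omega>\<bar>" for \<omega>
  proof -
    \<comment> \<open>The exit time: the weights are 1 before it and 0 from it on.\<close>
    define k where "k = (LEAST k. \<epsilon> \<le> \<bar>\<Sum>j<k. Y j \<omega>\<bar>)"
    have k: "\<epsilon> \<le> \<bar>\<Sum>j<k. Y j \<omega>\<bar>" unfolding k_def using that by (auto intro: LeastI)
    have kn: "k \<le> n" unfolding k_def using that by (auto intro: Least_le le_trans)
    have below: "\<bar>\<Sum>j<i. Y j \<omega>\<bar> < \<epsilon>" if "i < k" for i
      using not_less_Least[OF that[unfolded k_def]] by simp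
    have "transform G n \<omega> = (\<Sum>j<n. if j < k then Y j \<omega> else 0)"
      unfolding transform_def GY using below k by (intro sum.cong refl) (auto, meson not_le)
    also have "\<dots> = (\<Sum>j<k. Y j \<omega>)"
      using kn by (auto simp: sum.If_cases intro!: sum.cong)
    finally show ?thesis using k by simp
  qed
  have T: "integrable M (\<lambda>\<omega>. (transform G n \<omega>)\<^sup>2)"
      "expectation (\<lambda>\<omega>. (transform G n \<omega>)\<^sup>2) \<le> (\<Sum>j<n. expectation (\<lambda>\<omega>. (Y j \<omega>)\<^sup>2))"
    using transform_second_moment[of G n] by (auto simp: G_def)
  have "prob {\<omega>\<in>space M. \<exists>k\<le>n. \<epsilon> \<le> \<bar>\<Sum>j<k. Y j \<omega>\<bar>} \<le> prob {\<omega>\<in>space M. \<epsilon>\<^sup>2 \<le> (transform G n \<omega>)\<^sup>2}"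
  proof (rule finite_measure_mono)
    show "{\<omega>\<in>space M. \<exists>k\<le>n. \<epsilon> \<le> \<bar>\<Sum>j<k. Y j \<omega>\<bar>} \<subseteq> {\<omega>\<in>space M. \<epsilon>\<^sup>2 \<le> (transform G n \<omega>)\<^sup>2}"
      using stopped \<epsilon> by (auto simp: abs_le_square_iff[symmetric])
    show "{\<omega>\<in>space M. \<epsilon>\<^sup>2 \<le> (transform G n \<omega>)\<^sup>2} \<in> sets M" unfolding transform_def by measurable
  qed
  also have "\<dots> \<le> expectation (\<lambda>\<omega>. (transform G n \<omega>)\<^sup>2) / \<epsilon>\<^sup>2"
    using \<epsilon> by (intro integral_Markov_inequality_measure[OF T(1), of "{}"]) auto
  also have "\<dots> \<le> (\<Sum>j<n. expectation (\<lambda>\<omega>. (Y j \<omega>)\<^sup>2)) / \<epsilon>\<^sup>2"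
    using T(2) by (intro divide_right_mono) auto
  finally show ?thesis .
qed

lemma centered_indep_shift: "centered_indep M (\<lambda>k. Y (k + m))"
proof (unfold_locales)
  have "indep_vars (\<lambda>_. borel) (\<lambda>k. Y (k + m)) UNIV"
    using indep_vars_compose2[OF indep_vars_restrict[OF indep, of UNIV "\<lambda>k. {k + m}"],
        of "\<lambda>k y. y (k + m)" "\<lambda>_. borel"]
    by (simp add: disjoint_family_on_def)
  then show "indep_vars (\<lambda>_. borel) (\<lambda>k. Y (k + m)) UNIV" .
qed (rule square_integrable centered)+

lemma prob_tail_oscillation_le:
  assumes sm: "summable (\<lambda>k. expectation (\<lambda>\<omega>. (Y k \<omega>)\<^sup>2))" and \<epsilon>: "\<epsilon> > 0"
  shows "prob {\<omega>\<in>space M. \<exists>k. \<epsilon> \<le> \<bar>\<Sum>j<k. Y (j + m) \<omega>\<bar>} \<le> (\<Sum>k. expectation (\<lambda>\<omega>. (Y (k + m) \<omega>)\<^sup>2)) / \<epsilon>\<^sup>2"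
proof -
  interpret S: centered_indep M "\<lambda>k. Y (k + m)" by (rule centered_indep_shift)
  let ?A = "\<lambda>n. {\<omega>\<in>space M. \<exists>k\<le>n. \<epsilon> \<le> \<bar>\<Sum>j<k. Y (j + m) \<omega>\<bar>}"
  have sets: "range ?A \<subseteq> sets M" by auto
  have inc: "incseq ?A" by (auto simp: incseq_def intro: le_trans)
  have "(\<Union>n. ?A n) = {\<omega>\<in>space M. \<exists>k. \<epsilon> \<le> \<bar>\<Sum>j<k. Y (j + m) \<omega>\<bar>}" by auto
  then have "(\<lambda>n. prob (?A n)) \<longlonglongrightarrow> prob {\<omega>\<in>space M. \<exists>k. \<epsilon> \<le> \<bar>\<Sum>j<k. Y (j + m) \<omega>\<bar>}"
    using finite_Lim_measure_incseq[OF sets inc] by simp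
  moreover have "prob (?A n) \<le> (\<Sum>k. expectation (\<lambda>\<omega>. (Y (k + m) \<omega>)\<^sup>2)) / \<epsilon>\<^sup>2" for n
  proof -
    have "(\<Sum>j<n. expectation (\<lambda>\<omega>. (Y (j + m) \<omega>)\<^sup>2)) \<le> (\<Sum>k. expectation (\<lambda>\<omega>. (Y (k + m) \<omega>)\<^sup>2))"
      using sm by (intro sum_le_suminf) (auto simp: summable_iff_shift[of "\<lambda>k. expectation (\<lambda>\<omega>. (Y k \<omega>)\<^sup>2)"])
    then show ?thesis
      by (intro order_trans[OF S.kolmogorov_maximal_inequality[OF \<epsilon>]] divide_right_mono) auto
  qed
  ultimately show ?thesis by (intro LIMSEQ_le_const2) auto
qed

text \<open>The probability that the partial sums oscillate by at least $\varepsilon$ after time \<open>m\<close> is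
  bounded by a tail of the variance series. Almost surely the oscillation therefore falls below
  every $1/(i+1)$, and the partial sums are Cauchy.\<close>

theorem AE_summable:
  assumes sm: "summable (\<lambda>k. expectation (\<lambda>\<omega>. (Y k \<omega>)\<^sup>2))"
  shows "AE \<omega> in M. summable (\<lambda>k. Y k \<omega>)"
proof -
  have osc: "AE \<omega> in M. \<exists>m. \<forall>k. \<bar>\<Sum>j<k. Y (j + m) \<omega>\<bar> < \<epsilon>" if \<epsilon>: "\<epsilon> > 0" for \<epsilon>
  proof -
    let ?B = "\<lambda>m. {\<omega>\<in>space M. \<exists>k. \<epsilon> \<le> \<bar>\<Sum>j<k. Y (j + m) \<omega>\<bar>}"
    let ?v = "\<lambda>m. (\<Sum>k. expectation (\<lambda>\<omega>. (Y (k + m) \<omega>)\<^sup>2)) / \<epsilon>\<^sup>2"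
    have [measurable]: "?B m \<in> sets M" for m by measurable
    have "prob (\<Inter>m. ?B m) \<le> ?v m" for m
      by (rule order_trans[OF finite_measure_mono prob_tail_oscillation_le[OF sm \<epsilon>, of m]]) auto
    moreover have "?v \<longlonglongrightarrow> 0"
      using tendsto_divide[OF suminf_exist_split2[OF sm] tendsto_const[of "\<epsilon>\<^sup>2"]] \<epsilon> by simp
    ultimately have "prob (\<Inter>m. ?B m) \<le> 0" by (intro LIMSEQ_le_const[of ?v]) auto
    then have "(\<Inter>m. ?B m) \<in> null_sets M"
      by (intro null_setsI) (auto simp: emeasure_eq_measure measure_le_0_iff)
    then show ?thesis by (rule AE_I') (auto simp: not_less)
  qed
  have "AE \<omega> in M. \<forall>i. \<exists>m. \<forall>k. \<bar>\<Sum>j<k. Y (j + m) \<omega>\<bar> < 1 / real (Suc i)"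
    unfolding AE_all_countable using osc by simp
  then show ?thesis
  proof eventually_elim
    case (elim \<omega>)
    have "Cauchy (\<lambda>n. \<Sum>k<n. Y k \<omega>)"
    proof (rule metric_CauchyI)
      fix e :: real assume "e > 0"
      then obtain i where i: "1 / real (Suc i) < e / 2"
        using reals_Archimedean[of "e / 2"] by (auto simp: inverse_eq_divide)
      from elim obtain m where m: "\<And>k. \<bar>\<Sum>j<k. Y (j + m) \<omega>\<bar> < 1 / real (Suc i)" by blast
      have close: "\<bar>(\<Sum>k<n. Y k \<omega>) - (\<Sum>k<m. Y k \<omega>)\<bar> < e / 2" if "n \<ge> m" for n
      proof -
        have "(\<Sum>k<n. Y k \<omega>) - (\<Sum>k<m. Y k \<omega>) = (\<Sum>j<n - m. Y (j + m) \<omega>)"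
          using that sum_diff_nat_ivl[of 0 m n "\<lambda>k. Y k \<omega>"] sum.shift_bounds_nat_ivl[of "\<lambda>k. Y k \<omega>" 0 m "n - m"]
          by (simp add: atLeast0LessThan)
        then show ?thesis using m[of "n - m"] i by simp
      qed
      have "dist (\<Sum>k<n. Y k \<omega>) (\<Sum>k<n'. Y k \<omega>) < e" if "n \<ge> m" "n' \<ge> m" for n n'
        using close[OF that(1)] close[OF that(2)] unfolding dist_real_def by linarith
      then show "\<exists>M. \<forall>m\<ge>M. \<forall>n\<ge>M. dist (\<Sum>k<m. Y k \<omega>) (\<Sum>k<n. Y k \<omega>) < e" by blast
    qed
    then show "summable (\<lambda>k. Y k \<omega>)" by (simp add: summable_iff_convergent Cauchy_convergent_iff)
  qed
qed

text \<open>Fatou's lemma along the almost surely convergent partial sums.\<close>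

theorem second_moment_suminf_le:
  assumes sm: "summable (\<lambda>k. expectation (\<lambda>\<omega>. (Y k \<omega>)\<^sup>2))"
  shows "(\<integral>\<^sup>+\<omega>. ennreal ((\<Sum>k. Y k \<omega>)\<^sup>2) \<partial>M) \<le> ennreal (\<Sum>k. expectation (\<lambda>\<omega>. (Y k \<omega>)\<^sup>2))"
proof -
  let ?S = "\<lambda>n \<omega>. (\<Sum>k<n. Y k \<omega>)"
  have "(\<integral>\<^sup>+\<omega>. ennreal ((\<Sum>k. Y k \<omega>)\<^sup>2) \<partial>M) = (\<integral>\<^sup>+\<omega>. liminf (\<lambda>n. ennreal ((?S n \<omega>)\<^sup>2)) \<partial>M)"
  proof (rule nn_integral_cong_AE)
    show "AE \<omega> in M. ennreal ((\<Sum>k. Y k \<omega>)\<^sup>2) = liminf (\<lambda>n. ennreal ((?S n \<omega>)\<^sup>2))"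
      using AE_summable[OF sm]
    proof eventually_elim
      case (elim \<omega>)
      then have "(\<lambda>n. ennreal ((?S n \<omega>)\<^sup>2)) \<longlonglongrightarrow> ennreal ((\<Sum>k. Y k \<omega>)\<^sup>2)"
        by (intro tendsto_ennrealI tendsto_power summable_LIMSEQ)
      then show ?case by (intro lim_imp_Liminf[symmetric]) auto
    qed
  qed
  also have "\<dots> \<le> liminf (\<lambda>n. \<integral>\<^sup>+\<omega>. ennreal ((?S n \<omega>)\<^sup>2) \<partial>M)"
    by (intro nn_integral_liminf) auto
  also have "\<dots> \<le> limsup (\<lambda>n. \<integral>\<^sup>+\<omega>. ennreal ((?S n \<omega>)\<^sup>2) \<partial>M)" by (intro Liminf_le_Limsup) auto
  also have "\<dots> \<le> ennreal (\<Sum>k. expectation (\<lambda>\<omega>. (Y k \<omega>)\<^sup>2))"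
  proof (rule Limsup_bounded, rule always_eventually, rule allI)
    fix n
    have S: "integrable M (\<lambda>\<omega>. (?S n \<omega>)\<^sup>2)" "expectation (\<lambda>\<omega>. (?S n \<omega>)\<^sup>2) \<le> (\<Sum>j<n. expectation (\<lambda>\<omega>. (Y j \<omega>)\<^sup>2))"
      using transform_second_moment[of "\<lambda>_ _. 1" n] by (auto simp: transform_def)
    have "(\<integral>\<^sup>+\<omega>. ennreal ((?S n \<omega>)\<^sup>2) \<partial>M) = ennreal (expectation (\<lambda>\<omega>. (?S n \<omega>)\<^sup>2))"
      using S by (intro nn_integral_eq_integral) auto
    also have "\<dots> \<le> ennreal (\<Sum>k. expectation (\<lambda>\<omega>. (Y k \<omega>)\<^sup>2))"
      by (intro ennreal_leI order_trans[OF S(2)] sum_le_suminf sm) auto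
    finally show "(\<integral>\<^sup>+\<omega>. ennreal ((?S n \<omega>)\<^sup>2) \<partial>M) \<le> \<dots>" .
  qed
  finally show ?thesis .
qed

end

section \<open>Higher derivatives and moment series\<close>

lemma diffs_funpow:
  fixes c :: "nat \<Rightarrow> complex"
  shows "(diffs ^^ r) c n = fact (n + r) / fact n * c (n + r)"
proof (induction r arbitrary: n)
  case (Suc r)
  have "(diffs ^^ Suc r) c n = of_nat (Suc n) * (diffs ^^ r) c (Suc n)" by (simp add: diffs_def)
  also have "\<dots> = fact (n + Suc r) / fact n * c (n + Suc r)"
    unfolding Suc.IH fact_Suc[of n] by (simp del: of_nat_Suc fact_Suc)
  finally show ?case .
qed simp

text \<open>The function is real and given by its series only near 0. Locality of the derivative allows to
  differentiate repeatedly there, by induction over a statement on the whole interval.\<close>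

lemma higher_derivative_power_series_at_0:
  fixes f :: "real \<Rightarrow> complex" and c :: "nat \<Rightarrow> complex"
  assumes R: "R > 0"
    and sm: "\<And>z. norm z < R \<Longrightarrow> summable (\<lambda>n. c n * z ^ n)"
    and f: "\<And>t. \<bar>t\<bar> < R \<Longrightarrow> f t = (\<Sum>n. c n * of_real t ^ n)"
  shows "((\<lambda>f t. vector_derivative f (at t)) ^^ r) f 0 = fact r * c r"
proof -
  let ?D = "(\<lambda>f t. vector_derivative f (at t)) :: (real \<Rightarrow> complex) \<Rightarrow> real \<Rightarrow> complex"
  have "(\<forall>z. norm z < R \<longrightarrow> summable (\<lambda>n. (diffs ^^ r) c n * z ^ n)) \<and>
    (\<forall>t. \<bar>t\<bar> < R \<longrightarrow> (?D ^^ r) f t = (\<Sum>n. (diffs ^^ r) c n * of_real t ^ n))"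
  proof (induction r)
    case 0
    then show ?case using sm f by simp
  next
    case (Suc r)
    let ?c = "(diffs ^^ r) c"
    have "summable (\<lambda>n. diffs ?c n * z ^ n)" if "norm z < R" for z
      using Suc that by (intro termdiff_converges[of z R]) auto
    moreover have "?D ((?D ^^ r) f) t = (\<Sum>n. diffs ?c n * of_real t ^ n)" if t: "\<bar>t\<bar> < R" for t
    proof -
      have "((\<lambda>z. \<Sum>n. ?c n * z ^ n) has_field_derivative (\<Sum>n. diffs ?c n * of_real t ^ n)) (at (of_real t))"
        using Suc t by (intro termdiffs_strong'[of R]) auto
      then have "((\<lambda>t. \<Sum>n. ?c n * of_real t ^ n) has_vector_derivative (\<Sum>n. diffs ?c n * of_real t ^ n)) (at t)"
        by (rule has_vector_derivative_real_field)
      then have "((?D ^^ r) f has_vector_derivative (\<Sum>n. diffs ?c n * of_real t ^ n)) (at t)"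
      proof (rule has_vector_derivative_transform_within_open[of _ _ _ "{-R<..<R}"])
        show "(\<Sum>n. ?c n * of_real s ^ n) = (?D ^^ r) f s" if "s \<in> {-R<..<R}" for s
          using Suc that by auto
      qed (use t in auto)
      then show ?thesis by (rule vector_derivative_at)
    qed
    ultimately show ?case by simp
  qed
  then have "(?D ^^ r) f 0 = (\<Sum>n. (diffs ^^ r) c n * 0 ^ n)" using R by auto
  also have "\<dots> = fact r * c r" unfolding powser_zero by (simp add: diffs_funpow)
  finally show ?thesis .
qed

text \<open>$E[N^{2j}] / j!$ for a standard normal $N$: the power series coefficients of
  $E[e^{z N^2}] = (1 - 2z)^{-1/2}$.\<close>

definition chi_sq_coeff :: "nat \<Rightarrow> real" where
  "chi_sq_coeff j = fact (2 * j) / (2 ^ j * fact j * fact j)"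

lemma chi_sq_coeff_Suc: "chi_sq_coeff (Suc j) = chi_sq_coeff j * ((2 * real j + 1) / (real j + 1))"
proof -
  have "fact (2 * Suc j) = (2 * real j + 2) * (2 * real j + 1) * fact (2 * j)" by (simp add: algebra_simps)
  then show ?thesis unfolding chi_sq_coeff_def by (simp add: divide_simps) (simp add: algebra_simps)
qed

lemma chi_sq_coeff_nonneg: "chi_sq_coeff j \<ge> 0"
  by (simp add: chi_sq_coeff_def)

lemma chi_sq_coeff_le: "chi_sq_coeff j \<le> 2 ^ j"
proof (induction j)
  case (Suc j)
  have "chi_sq_coeff (Suc j) \<le> chi_sq_coeff j * 2"
    unfolding chi_sq_coeff_Suc by (intro mult_left_mono chi_sq_coeff_nonneg) (simp add: divide_simps)
  with Suc show ?case by simp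
qed (simp add: chi_sq_coeff_def)

lemma chi_sq_coeff_gbinomial:
  "complex_of_real (chi_sq_coeff j) * z ^ j = ((-1/2) gchoose j) * (- 2 * z) ^ j"
proof (induction j)
  case (Suc j)
  have *: "((-1/2 :: complex) gchoose Suc j) = (-1/2 gchoose j) * ((-1/2 - of_nat j) / of_nat (Suc j))"
    by (simp add: gbinomial_prod_rev prod.atLeast0_lessThan_Suc del: of_nat_Suc)
  have "complex_of_real (chi_sq_coeff (Suc j)) * z ^ Suc j =
      (complex_of_real (chi_sq_coeff j) * z ^ j) * (((2 * of_nat j + 1) / (of_nat j + 1)) * z)"
    unfolding chi_sq_coeff_Suc by simp
  also have "(2 * of_nat j + 1) / (of_nat j + 1) * z = ((-1/2 - of_nat j) / of_nat (Suc j)) * (- 2 * z)"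
  proof -
    have "(-1/2 - of_nat j) * (- 2 * z) = (2 * of_nat j + 1) * z" by (simp add: algebra_simps)
    then show ?thesis unfolding times_divide_eq_left by (simp add: add.commute)
  qed
  finally show ?case unfolding Suc * by (simp add: mult_ac)
qed (simp add: chi_sq_coeff_def)

section \<open>Second-chaos series: moments, characteristic function, cumulants\<close>

locale std_normal_sequence = prob_space +
  fixes N :: "nat \<Rightarrow> 'a \<Rightarrow> real"
  assumes indep: "indep_vars (\<lambda>_. borel) N UNIV"
    and normal: "distributed M lborel (N k) (\<lambda>x. ennreal (std_normal_density x))"
begin

lemma measurable_N [measurable]: "N k \<in> borel_measurable M"
  using distributed_measurable[OF normal[of k]] by simp

lemma even_moment:
  "integrable M (\<lambda>\<omega>. N k \<omega> ^ (2 * j))"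
  "expectation (\<lambda>\<omega>. N k \<omega> ^ (2 * j)) = fact (2 * j) / (2 ^ j * fact j)"
  using distributed_integrable[OF normal[of k], of "\<lambda>x. x ^ (2 * j)"]
    distributed_integral[OF normal[of k], of "\<lambda>x. x ^ (2 * j)"]
    std_normal_moment_even[of j]
  by (auto simp: has_bochner_integral_iff)

lemma hermite2_moments:
  shows "integrable M (\<lambda>\<omega>. ((N k \<omega>)\<^sup>2 - 1)\<^sup>2)"
    and "expectation (\<lambda>\<omega>. (N k \<omega>)\<^sup>2 - 1) = 0"
    and "expectation (\<lambda>\<omega>. ((N k \<omega>)\<^sup>2 - 1)\<^sup>2) = 2"
proof -
  have 2: "integrable M (\<lambda>\<omega>. (N k \<omega>)\<^sup>2)" "expectation (\<lambda>\<omega>. (N k \<omega>)\<^sup>2) = 1"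
    using even_moment[of k 1] by auto
  have 4: "integrable M (\<lambda>\<omega>. N k \<omega> ^ 4)" "expectation (\<lambda>\<omega>. N k \<omega> ^ 4) = 3"
    using even_moment[of k 2] by (auto simp: fact_numeral)
  have eq: "((N k \<omega>)\<^sup>2 - 1)\<^sup>2 = N k \<omega> ^ 4 - 2 * (N k \<omega>)\<^sup>2 + 1" for \<omega>
    by (simp add: power2_diff power_mult[symmetric])
  show "integrable M (\<lambda>\<omega>. ((N k \<omega>)\<^sup>2 - 1)\<^sup>2)"
    "expectation (\<lambda>\<omega>. (N k \<omega>)\<^sup>2 - 1) = 0" "expectation (\<lambda>\<omega>. ((N k \<omega>)\<^sup>2 - 1)\<^sup>2) = 2"
    unfolding eq using 2 4 by (simp_all add: prob_space)
qed

lemma chaos_terms_indep: "indep_vars (\<lambda>_. borel) (\<lambda>k \<omega>. a k * ((N k \<omega>)\<^sup>2 - 1)) UNIV"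
  by (rule indep_vars_compose2[OF indep]) simp

lemma chaos_terms: "centered_indep M (\<lambda>k \<omega>. a k * ((N k \<omega>)\<^sup>2 - 1))"
proof unfold_locales
  show "indep_vars (\<lambda>_. borel) (\<lambda>k \<omega>. a k * ((N k \<omega>)\<^sup>2 - 1)) UNIV" by (rule chaos_terms_indep)
  show "integrable M (\<lambda>\<omega>. (a k * ((N k \<omega>)\<^sup>2 - 1))\<^sup>2)" for k
    unfolding power_mult_distrib using hermite2_moments(1) by simp
  show "expectation (\<lambda>\<omega>. a k * ((N k \<omega>)\<^sup>2 - 1)) = 0" for k
    using hermite2_moments(2) by simp
qed

lemma chaos_term_variance: "expectation (\<lambda>\<omega>. (a k * ((N k \<omega>)\<^sup>2 - 1))\<^sup>2) = 2 * (a k)\<^sup>2"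
  unfolding power_mult_distrib using hermite2_moments(3) by simp

lemma chaos2_measurable [measurable]: "chaos2 N a \<in> borel_measurable M"
  unfolding chaos2_def[abs_def] by measurable

lemma chaos2_AE_summable:
  "summable (\<lambda>k. (a k)\<^sup>2) \<Longrightarrow> AE \<omega> in M. summable (\<lambda>k. a k * ((N k \<omega>)\<^sup>2 - 1))"
  by (rule centered_indep.AE_summable[OF chaos_terms]) (simp add: chaos_term_variance)

lemma chaos2_L2_le:
  assumes "summable (\<lambda>k. (a k)\<^sup>2)"
  shows "(\<integral>\<^sup>+\<omega>. ennreal ((chaos2 N a \<omega>)\<^sup>2) \<partial>M) \<le> ennreal (2 * (\<Sum>k. (a k)\<^sup>2))"
  using centered_indep.second_moment_suminf_le[OF chaos_terms, of a] assms
  by (simp add: chaos_term_variance chaos2_def suminf_mult)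

text \<open>The second moment of a difference follows from linearity, which holds only where both series
  converge.\<close>

lemma chaos2_diff_L2_le:
  assumes a: "summable (\<lambda>k. (a k)\<^sup>2)" and b: "summable (\<lambda>k. (b k)\<^sup>2)"
    and ab: "summable (\<lambda>k. (a k - b k)\<^sup>2)"
  shows "(\<integral>\<^sup>+\<omega>. ennreal (\<bar>chaos2 N a \<omega> - chaos2 N b \<omega>\<bar>\<^sup>2) \<partial>M) \<le> ennreal (2 * (\<Sum>k. (a k - b k)\<^sup>2))"
proof -
  have "AE \<omega> in M. chaos2 N a \<omega> - chaos2 N b \<omega> = chaos2 N (\<lambda>k. a k - b k) \<omega>"
    using chaos2_AE_summable[OF a] chaos2_AE_summable[OF b]
    by eventually_elim (simp add: chaos2_def suminf_diff left_diff_distrib)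
  then have "(\<integral>\<^sup>+\<omega>. ennreal (\<bar>chaos2 N a \<omega> - chaos2 N b \<omega>\<bar>\<^sup>2) \<partial>M) =
      (\<integral>\<^sup>+\<omega>. ennreal ((chaos2 N (\<lambda>k. a k - b k) \<omega>)\<^sup>2) \<partial>M)"
    by (intro nn_integral_cong_AE) (auto elim!: eventually_mono)
  then show ?thesis using chaos2_L2_le[OF ab] by simp
qed

text \<open>For $|s| < 1/2$ the exponential series can be integrated term by term, and the even moments of the
  normal distribution add up to a binomial series.\<close>

lemma char_square:
  assumes s: "\<bar>s\<bar> < 1 / 2"
  shows "(CLINT \<omega>|M. iexp (s * (N k \<omega>)\<^sup>2)) = exp (- Ln (1 - 2 * \<i> * s) / 2)"
proof -
  define f where "f j \<omega> = (\<i> * complex_of_real s) ^ j / fact j * complex_of_real (N k \<omega> ^ (2 * j))" for j \<omega>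
  have fsums: "(\<lambda>j. f j \<omega>) sums iexp (s * (N k \<omega>)\<^sup>2)" for \<omega>
  proof -
    have "f j \<omega> = (\<i> * complex_of_real (s * (N k \<omega>)\<^sup>2)) ^ j /\<^sub>R fact j" for j
      unfolding f_def by (simp add: power_mult_distrib power_mult scaleR_conv_of_real divide_simps)
    then show ?thesis using exp_converges[of "\<i> * complex_of_real (s * (N k \<omega>)\<^sup>2)"] by simp
  qed
  have normf: "norm (f j \<omega>) = \<bar>s\<bar> ^ j / fact j * N k \<omega> ^ (2 * j)" for j \<omega>
    unfolding f_def by (simp add: norm_mult norm_divide norm_power power_even_abs)
  have int: "integrable M (f j)" for j
    unfolding f_def[abs_def] by (intro integrable_mult_right integrable_of_real even_moment)
  have "summable (\<lambda>j. norm (f j \<omega>))" for \<omega>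
  proof -
    have "norm (f j \<omega>) = (\<bar>s\<bar> * (N k \<omega>)\<^sup>2) ^ j /\<^sub>R fact j" for j
      unfolding normf by (simp add: power_mult_distrib power_mult divide_simps)
    then show ?thesis using sums_summable[OF exp_converges[of "\<bar>s\<bar> * (N k \<omega>)\<^sup>2"]] by simp
  qed
  moreover have "summable (\<lambda>j. expectation (\<lambda>\<omega>. norm (f j \<omega>)))"
  proof (rule summable_comparison_test)
    have "expectation (\<lambda>\<omega>. norm (f j \<omega>)) = \<bar>s\<bar> ^ j * chi_sq_coeff j" for j
      unfolding normf using even_moment[of k j] by (simp add: chi_sq_coeff_def mult_ac)
    moreover have "\<bar>s\<bar> ^ j * chi_sq_coeff j \<le> (2 * \<bar>s\<bar>) ^ j" for j
      using mult_left_mono[OF chi_sq_coeff_le[of j], of "\<bar>s\<bar> ^ j"] by (simp add: power_mult_distrib mult_ac)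
    ultimately show "\<exists>n. \<forall>j\<ge>n. norm (expectation (\<lambda>\<omega>. norm (f j \<omega>))) \<le> (2 * \<bar>s\<bar>) ^ j"
      using chi_sq_coeff_nonneg by simp
    show "summable (\<lambda>j. (2 * \<bar>s\<bar>) ^ j)" using s by (intro summable_geometric) auto
  qed
  ultimately have "(\<lambda>j. expectation (f j)) sums (\<integral>\<omega>. (\<Sum>j. f j \<omega>) \<partial>M)"
    by (intro sums_integral int) auto
  moreover have "expectation (f j) = complex_of_real (chi_sq_coeff j) * (\<i> * s) ^ j" for j
    unfolding f_def using even_moment[of k j] by (simp add: chi_sq_coeff_def mult_ac del: of_real_power)
  ultimately have "(\<lambda>j. ((-1/2) gchoose j) * (- 2 * (\<i> * s)) ^ j) sums (CLINT \<omega>|M. iexp (s * (N k \<omega>)\<^sup>2))"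
    unfolding chi_sq_coeff_gbinomial[symmetric] using fsums by (simp add: sums_iff)
  moreover have "(\<lambda>j. ((-1/2) gchoose j) * (- 2 * (\<i> * s)) ^ j) sums ((1 + (- 2 * (\<i> * s))) powr (-1/2))"
    using s by (intro gen_binomial_complex) (simp add: norm_mult)
  ultimately have "(CLINT \<omega>|M. iexp (s * (N k \<omega>)\<^sup>2)) = (1 + (- 2 * (\<i> * s))) powr (-1/2)"
    by (rule sums_unique2)
  moreover have "1 - 2 * \<i> * complex_of_real s \<noteq> 0"
    by (auto simp: complex_eq_iff)
  ultimately show ?thesis by (simp add: powr_def mult_ac)
qed

end

text \<open>The power series coefficients of $-is - \frac12 \log(1 - 2is)$, the logarithm of the
  characteristic function of $N^2 - 1$ at $s$. The subtracted mean cancels the linear term.\<close>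

definition log_char_coeff :: "nat \<Rightarrow> complex" where
  "log_char_coeff n = (if n < 2 then 0 else (2 * \<i>) ^ n / (2 * of_nat n))"

lemma log_char_coeff_norm: "norm (log_char_coeff n) \<le> 2 ^ n / 4"
proof (cases "n < 2")
  case False
  have "(2::real) ^ n / (2 * real n) \<le> 2 ^ n / 4" using False by (intro divide_left_mono) auto
  then show ?thesis using False by (simp add: log_char_coeff_def norm_divide norm_mult norm_power)
qed (simp add: log_char_coeff_def)

lemma log_char_coeff_sums:
  assumes s: "\<bar>s\<bar> < 1 / 2"
  shows "(\<lambda>n. log_char_coeff n * of_real s ^ n) sums (- \<i> * of_real s - Ln (1 - 2 * \<i> * of_real s) / 2)"
proof -
  have "norm (- 2 * \<i> * complex_of_real s) < 1" using s by (simp add: norm_mult)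
  from Ln_series'[OF this]
  have "(\<lambda>n. - ((2 * \<i> * complex_of_real s) ^ n) / of_nat n) sums Ln (1 - 2 * \<i> * s)" by simp
  from sums_divide[OF sums_minus[OF this], of 2]
  have "(\<lambda>n. (2 * \<i> * complex_of_real s) ^ n / (2 * of_nat n)) sums (- Ln (1 - 2 * \<i> * s) / 2)"
    by (simp add: field_simps)
  moreover have "(\<lambda>n. if n = 1 then \<i> * complex_of_real s else 0) sums (\<i> * s)" by (rule sums_single)
  ultimately have "(\<lambda>n. (2 * \<i> * complex_of_real s) ^ n / (2 * of_nat n) - (if n = 1 then \<i> * complex_of_real s else 0))
      sums (- Ln (1 - 2 * \<i> * s) / 2 - \<i> * s)" by (rule sums_diff)
  moreover have "(2 * \<i> * complex_of_real s) ^ n / (2 * of_nat n) - (if n = 1 then \<i> * complex_of_real s else 0) =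
      log_char_coeff n * of_real s ^ n" for n
    by (cases "n = 0"; cases "n = 1") (auto simp: log_char_coeff_def power_mult_distrib)
  moreover have "- Ln (1 - 2 * \<i> * s) / 2 - \<i> * s = - \<i> * s - Ln (1 - 2 * \<i> * s) / 2" by simp
  ultimately show ?thesis by (simp only:)
qed

context std_normal_sequence
begin

lemma char_chaos_term:
  assumes "\<bar>t * a\<bar> < 1 / 2"
  shows "char (distr M borel (\<lambda>\<omega>. a * ((N k \<omega>)\<^sup>2 - 1))) t = exp (\<Sum>n. log_char_coeff n * of_real (t * a) ^ n)"
proof -
  have "char (distr M borel (\<lambda>\<omega>. a * ((N k \<omega>)\<^sup>2 - 1))) t = (CLINT \<omega>|M. iexp (t * (a * ((N k \<omega>)\<^sup>2 - 1))))"
    unfolding char_def by (rule integral_distr) auto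
  also have "\<dots> = (CLINT \<omega>|M. exp (- \<i> * (t * a)) * iexp ((t * a) * (N k \<omega>)\<^sup>2))"
    by (intro Bochner_Integration.integral_cong refl) (simp add: exp_add[symmetric] algebra_simps)
  also have "\<dots> = exp (- \<i> * (t * a)) * exp (- Ln (1 - 2 * \<i> * (t * a)) / 2)"
    using char_square[OF assms, of k] by simp
  also have "\<dots> = exp (- \<i> * of_real (t * a) - Ln (1 - 2 * \<i> * of_real (t * a)) / 2)"
    by (simp add: exp_add[symmetric])
  also have "\<dots> = exp (\<Sum>n. log_char_coeff n * of_real (t * a) ^ n)"
    using log_char_coeff_sums[OF assms] by (simp only: sums_iff)
  finally show ?thesis .
qed

lemma char_chaos2_LIMSEQ:
  assumes a: "summable (\<lambda>k. (a k)\<^sup>2)"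
  shows "(\<lambda>m. char (distr M borel (\<lambda>\<omega>. \<Sum>k<m. a k * ((N k \<omega>)\<^sup>2 - 1))) t) \<longlonglongrightarrow> char (distr M borel (chaos2 N a)) t"
proof -
  have c: "char (distr M borel X) t = (CLINT \<omega>|M. iexp (t * X \<omega>))" if "X \<in> borel_measurable M" for X
    unfolding char_def using that by (intro integral_distr) auto
  show ?thesis
  proof (subst (1 2) c)
    show "(\<lambda>m. CLINT \<omega>|M. iexp (t * (\<Sum>k<m. a k * ((N k \<omega>)\<^sup>2 - 1)))) \<longlonglongrightarrow> (CLINT \<omega>|M. iexp (t * chaos2 N a \<omega>))"
    proof (rule integral_dominated_convergence[where w="\<lambda>_. 1"])
      show "AE \<omega> in M. (\<lambda>m. iexp (t * (\<Sum>k<m. a k * ((N k \<omega>)\<^sup>2 - 1)))) \<longlonglongrightarrow> iexp (t * chaos2 N a \<omega>)"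
        using chaos2_AE_summable[OF a]
        by eventually_elim
          (unfold chaos2_def, intro tendsto_exp tendsto_mult tendsto_const tendsto_of_real summable_LIMSEQ)
    qed auto
  qed auto
qed

text \<open>For finitely many terms the logarithms of the characteristic functions are added, which replaces
  $a^n$ by a power sum in each coefficient of the series. Tannery's theorem passes to infinitely
  many terms; the summands with $n < 2$, where the power sum may diverge, have coefficient 0.\<close>

lemma char_chaos2_near_0:
  assumes a: "(\<lambda>k. (a k)\<^sup>2) sums 1" and t: "\<bar>t\<bar> < 1 / 4"
  shows "char (distr M borel (chaos2 N a)) t = exp (\<Sum>n. log_char_coeff n * of_real (\<Sum>k. a k ^ n) * of_real t ^ n)"
proof -
  let ?c = "log_char_coeff"
  have a1: "\<bar>a k\<bar> \<le> 1" for k by (rule sq_sums_1_abs_le[OF a])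
  have sm: "summable (\<lambda>k. (a k)\<^sup>2)" using a by (simp add: sums_iff)
  have ta: "\<bar>t * a k\<bar> < 1 / 2" for k
    using t a1[of k] mult_mono[of "\<bar>t\<bar>" "1/4" "\<bar>a k\<bar>" 1] by (simp add: abs_mult)
  have le_sq: "\<bar>a k ^ n\<bar> \<le> (a k)\<^sup>2" if "n \<ge> 2" for n k
    using power_decreasing[OF that, of "\<bar>a k\<bar>"] a1 by (simp add: power_abs)
  have sma: "summable (\<lambda>k. a k ^ n)" if "n \<ge> 2" for n
    using le_sq[OF that] by (intro summable_comparison_test[OF _ sm]) auto
  have partial: "char (distr M borel (\<lambda>\<omega>. \<Sum>k<m. a k * ((N k \<omega>)\<^sup>2 - 1))) t =
      exp (\<Sum>n. ?c n * of_real (\<Sum>k<m. a k ^ n) * of_real t ^ n)" for m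
  proof -
    have "char (distr M borel (\<lambda>\<omega>. \<Sum>k<m. a k * ((N k \<omega>)\<^sup>2 - 1))) t =
        (\<Prod>k<m. exp (\<Sum>n. ?c n * of_real (t * a k) ^ n))"
      by (subst char_distr_sum[OF indep_vars_subset[OF chaos_terms_indep subset_UNIV]])
        (intro prod.cong refl char_chaos_term ta)
    also have "\<dots> = exp (\<Sum>k<m. \<Sum>n. ?c n * of_real (t * a k) ^ n)" by (simp add: exp_sum)
    also have "(\<Sum>k<m. \<Sum>n. ?c n * of_real (t * a k) ^ n) = (\<Sum>n. \<Sum>k<m. ?c n * of_real (t * a k) ^ n)"
      by (rule suminf_sum[symmetric]) (rule sums_summable[OF log_char_coeff_sums[OF ta]])
    also have "\<dots> = (\<Sum>n. ?c n * of_real (\<Sum>k<m. a k ^ n) * of_real t ^ n)"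
      by (simp add: sum_distrib_left sum_distrib_right power_mult_distrib mult_ac)
    finally show ?thesis .
  qed
  have "(\<lambda>m. \<Sum>n. ?c n * of_real (\<Sum>k<m. a k ^ n) * of_real t ^ n) \<longlonglongrightarrow> (\<Sum>n. ?c n * of_real (\<Sum>k. a k ^ n) * of_real t ^ n)"
  proof (rule tannerys_theorem[where M="\<lambda>n. (1/2) ^ n", THEN conjunct2, THEN conjunct2])
    show "(\<lambda>m. ?c n * of_real (\<Sum>k<m. a k ^ n) * of_real t ^ n) \<longlonglongrightarrow> ?c n * of_real (\<Sum>k. a k ^ n) * of_real t ^ n" for n
    proof (cases "n < 2")
      case False
      then show ?thesis by (intro tendsto_intros summable_LIMSEQ sma) auto
    qed (simp add: log_char_coeff_def)
    have "norm (?c n * of_real (\<Sum>k<m. a k ^ n) * of_real t ^ n) \<le> (1/2) ^ n" for n m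
    proof (cases "n < 2")
      case False
      have "\<bar>\<Sum>k<m. a k ^ n\<bar> \<le> (\<Sum>k<m. (a k)\<^sup>2)"
        using False le_sq[of n] by (intro order_trans[OF sum_abs] sum_mono) auto
      also have "\<dots> \<le> 1" using sum_le_suminf[OF sm, of "{..<m}"] a by (simp add: sums_iff)
      finally have S: "\<bar>\<Sum>k<m. a k ^ n\<bar> \<le> 1" .
      have "norm (?c n * of_real (\<Sum>k<m. a k ^ n) * of_real t ^ n) = norm (?c n) * \<bar>\<Sum>k<m. a k ^ n\<bar> * \<bar>t\<bar> ^ n"
        by (simp only: norm_mult norm_power norm_of_real)
      also have "\<dots> \<le> 2 ^ n * 1 * (1/4) ^ n"
        using t S order_trans[OF log_char_coeff_norm, of n "2 ^ n"] by (intro mult_mono power_mono) auto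
      also have "\<dots> = (1/2) ^ n" by (simp add: power_mult_distrib[symmetric])
      finally show ?thesis .
    qed (simp add: log_char_coeff_def)
    then show "\<forall>\<^sub>F (n, m) in at_top \<times>\<^sub>F sequentially. norm (?c n * of_real (\<Sum>k<m. a k ^ n) * of_real t ^ n) \<le> (1/2) ^ n"
      by (intro always_eventually) auto
  qed (auto intro!: summable_geometric)
  then have "(\<lambda>m. char (distr M borel (\<lambda>\<omega>. \<Sum>k<m. a k * ((N k \<omega>)\<^sup>2 - 1))) t) \<longlonglongrightarrow>
      exp (\<Sum>n. ?c n * of_real (\<Sum>k. a k ^ n) * of_real t ^ n)"
    unfolding partial by (rule tendsto_exp)
  then show ?thesis by (rule LIMSEQ_unique[OF char_chaos2_LIMSEQ[OF sm]])
qed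

text \<open>The exponent in the characteristic function has modulus at most 1/2 near 0, so it is the principal
  logarithm there, and the cumulants can be read off its coefficients.\<close>

lemma cumulant_chaos2:
  assumes a: "(\<lambda>k. (a k)\<^sup>2) sums 1" and r: "r \<ge> 2"
  shows "cumulant r (distr M borel (chaos2 N a)) = 2 ^ (r - 1) * fact (r - 1) * (\<Sum>k. a k ^ r)"
proof -
  have a1: "\<bar>a k\<bar> \<le> 1" for k by (rule sq_sums_1_abs_le[OF a])
  define c where "c n = log_char_coeff n * complex_of_real (\<Sum>k. a k ^ n)" for n
  have sm: "summable (\<lambda>k. (a k)\<^sup>2)" using a by (simp add: sums_iff)
  have c_norm: "norm (c n) \<le> 2 ^ n / 4" for n
  proof (cases "n < 2")
    case False
    then have le_sq: "\<bar>a k ^ n\<bar> \<le> (a k)\<^sup>2" for k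
      using power_decreasing[of 2 n "\<bar>a k\<bar>"] a1 by (simp add: power_abs)
    then have "norm (\<Sum>k. a k ^ n) \<le> (\<Sum>k. (a k)\<^sup>2)" by (intro norm_suminf_le sm) auto
    then have S: "\<bar>\<Sum>k. a k ^ n\<bar> \<le> 1" using a by (simp add: sums_iff)
    have "norm (c n) = norm (log_char_coeff n) * \<bar>\<Sum>k. a k ^ n\<bar>"
      unfolding c_def by (simp only: norm_mult norm_of_real)
    also have "\<dots> \<le> 2 ^ n / 4 * 1" by (intro mult_mono log_char_coeff_norm S) auto
    finally show ?thesis by simp
  qed (simp add: c_def log_char_coeff_def)
  have c_bound: "norm (c n * z ^ n) \<le> (1/2) ^ n / 4" if "norm z < 1/4" for n z
  proof -
    have "norm (c n * z ^ n) \<le> 2 ^ n / 4 * (1/4) ^ n"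
      unfolding norm_mult norm_power using that by (intro mult_mono c_norm power_mono) auto
    also have "\<dots> = (1/2) ^ n / 4" by (simp add: power_mult_distrib[symmetric])
    finally show ?thesis .
  qed
  have geo: "summable (\<lambda>n. (1/2::real) ^ n / 4)" by (intro summable_divide summable_geometric) auto
  have "((\<lambda>f t. vector_derivative f (at t)) ^^ r) (\<lambda>t. Ln (char (distr M borel (chaos2 N a)) t)) 0 = fact r * c r"
  proof (rule higher_derivative_power_series_at_0[of "1/4"])
    show "summable (\<lambda>n. c n * z ^ n)" if "norm z < 1/4" for z
      using c_bound[OF that] by (intro summable_comparison_test[OF _ geo]) auto
    fix t :: real assume t: "\<bar>t\<bar> < 1/4"
    let ?L = "\<Sum>n. c n * of_real t ^ n"
    have "norm ?L \<le> (\<Sum>n. (1/2) ^ n / 4)" using t by (intro norm_suminf_le geo c_bound) auto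
    also have "\<dots> = 1 / 2" by (simp add: suminf_divide suminf_geometric summable_geometric)
    finally have "\<bar>Im ?L\<bar> < pi" using abs_Im_le_cmod[of ?L] pi_gt3 by linarith
    then show "Ln (char (distr M borel (chaos2 N a)) t) = ?L"
      unfolding char_chaos2_near_0[OF a t] c_def[symmetric] by (intro Ln_exp) auto
  qed simp
  then have "cumulant r (distr M borel (chaos2 N a)) = Re ((- \<i>) ^ r * (fact r * c r))"
    unfolding cumulant_def by simp
  also have "(- \<i>) ^ r * (fact r * c r) = of_real (2 ^ r * fact r / (2 * real r) * (\<Sum>k. a k ^ r))"
  proof -
    have "- \<i> * (2 * \<i>) = 2" by (simp add: complex_eq_iff)
    then have "(- \<i>) ^ r * (2 * \<i>) ^ r = 2 ^ r" unfolding power_mult_distrib[symmetric] by simp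
    then show ?thesis using r by (simp add: c_def log_char_coeff_def mult_ac)
  qed
  also have "2 ^ r * fact r / (2 * real r) = 2 ^ (r - 1) * fact (r - 1)"
    using r by (cases r) (simp_all add: field_simps)
  finally show ?thesis by simp
qed

end

section \<open>Wasserstein distance and characteristic functions\<close>

text \<open>Random variables on a common probability space are a coupling of their laws.\<close>

lemma wasserstein2_le_coupled:
  assumes M: "prob_space M" and [measurable]: "X \<in> borel_measurable M" "Y \<in> borel_measurable M"
    and le: "(\<integral>\<^sup>+\<omega>. ennreal (\<bar>X \<omega> - Y \<omega>\<bar>\<^sup>2) \<partial>M) \<le> ennreal x" and x: "x \<ge> 0"
  shows "wasserstein2 (distr M borel X) (distr M borel Y) \<le> ennreal (sqrt x)"
proof -
  interpret prob_space M by fact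
  let ?\<gamma> = "distr M (borel \<Otimes>\<^sub>M borel) (\<lambda>\<omega>. (X \<omega>, Y \<omega>))"
  have \<gamma>: "?\<gamma> \<in> couplings (distr M borel X) (distr M borel Y)"
    unfolding couplings_def by (auto intro!: prob_space_distr simp: distr_distr comp_def)
  let ?c = "INF \<gamma>\<in>couplings (distr M borel X) (distr M borel Y). \<integral>\<^sup>+ z. ennreal (\<bar>fst z - snd z\<bar>\<^sup>2) \<partial>\<gamma>"
  have "?c \<le> (\<integral>\<^sup>+ z. ennreal (\<bar>fst z - snd z\<bar>\<^sup>2) \<partial>?\<gamma>)" by (rule INF_lower[OF \<gamma>])
  also have "\<dots> = (\<integral>\<^sup>+\<omega>. ennreal (\<bar>X \<omega> - Y \<omega>\<bar>\<^sup>2) \<partial>M)" by (subst nn_integral_distr) auto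
  finally have c: "?c \<le> ennreal x" using le by (rule order_trans)
  then have "?c < \<infinity>" by (rule le_less_trans) simp
  then have "?c \<noteq> \<infinity>" by (rule less_imp_neq)
  moreover have "enn2real ?c \<le> x" using c x by (metis enn2real_ennreal enn2real_mono ennreal_less_top)
  ultimately show ?thesis unfolding wasserstein2_def Let_def by (auto intro!: ennreal_leI)
qed

lemma norm_iexp_diff_le: "norm (iexp x - iexp y) \<le> \<bar>x - y\<bar>"
proof -
  have "iexp x - iexp y = iexp y * (iexp (x - y) - 1)"
    by (simp add: right_diff_distrib exp_add[symmetric] algebra_simps)
  then have "norm (iexp x - iexp y) = norm (iexp (x - y) - 1)" by (simp add: norm_mult)
  also have "\<dots> \<le> \<bar>x - y\<bar>" using iexp_approx1[of "x - y" 0] by simp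
  finally show ?thesis .
qed

text \<open>The map $x \mapsto e^{itx}$ is Lipschitz with constant $|t|$, and the first absolute moment is at
  most the root of the second.\<close>

lemma char_diff_le_coupling_cost:
  assumes \<gamma>: "\<gamma> \<in> couplings \<mu> \<nu>" and cost: "(\<integral>\<^sup>+ z. ennreal (\<bar>fst z - snd z\<bar>\<^sup>2) \<partial>\<gamma>) \<le> ennreal x" and x: "x \<ge> 0"
  shows "norm (char \<mu> t - char \<nu> t) \<le> \<bar>t\<bar> * sqrt x"
proof -
  have \<mu>: "distr \<gamma> borel fst = \<mu>" and \<nu>: "distr \<gamma> borel snd = \<nu>" and [measurable_cong]: "sets \<gamma> = sets (borel \<Otimes>\<^sub>M borel)"
    using \<gamma> by (auto simp: couplings_def)
  interpret prob_space \<gamma> using \<gamma> by (simp add: couplings_def)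
  have intsq: "integrable \<gamma> (\<lambda>z. (fst z - snd z)\<^sup>2)"
    using cost by (intro integrableI_bounded) (auto simp: less_top[symmetric] top_unique)
  have sq: "expectation (\<lambda>z. (fst z - snd z)\<^sup>2) \<le> x"
    using cost x by (subst (asm) nn_integral_eq_integral) (use intsq in auto)
  have int: "integrable \<gamma> (\<lambda>z. \<bar>fst z - snd z\<bar>)"
    by (intro integrable_abs square_integrable_imp_integrable[OF _ intsq]) simp
  have "(expectation (\<lambda>z. \<bar>fst z - snd z\<bar>))\<^sup>2 \<le> expectation (\<lambda>z. (fst z - snd z)\<^sup>2)"
    using variance_positive[of "\<lambda>z. \<bar>fst z - snd z\<bar>"] variance_eq[OF int] intsq by simp
  then have E: "expectation (\<lambda>z. \<bar>fst z - snd z\<bar>) \<le> sqrt x"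
    using sq by (intro real_le_rsqrt) auto
  have ch: "char \<mu> t = (CLINT z|\<gamma>. iexp (t * fst z))" "char \<nu> t = (CLINT z|\<gamma>. iexp (t * snd z))"
    unfolding char_def \<mu>[symmetric] \<nu>[symmetric] by (auto intro!: integral_distr)
  have i1: "integrable \<gamma> (\<lambda>z. iexp (t * fst z))" "integrable \<gamma> (\<lambda>z. iexp (t * snd z))"
    by (auto intro!: integrable_const_bound[where B=1])
  have "norm (char \<mu> t - char \<nu> t) = norm (CLINT z|\<gamma>. iexp (t * fst z) - iexp (t * snd z))"
    unfolding ch using i1 by simp
  also have "\<dots> \<le> expectation (\<lambda>z. norm (iexp (t * fst z) - iexp (t * snd z)))" by (rule integral_norm_bound)
  also have "\<dots> \<le> expectation (\<lambda>z. \<bar>t\<bar> * \<bar>fst z - snd z\<bar>)"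
  proof (rule integral_mono)
    show "norm (iexp (t * fst z) - iexp (t * snd z)) \<le> \<bar>t\<bar> * \<bar>fst z - snd z\<bar>" for z
      using norm_iexp_diff_le[of "t * fst z" "t * snd z"] by (simp add: right_diff_distrib[symmetric] abs_mult)
  qed (use i1 int in auto)
  also have "\<dots> = \<bar>t\<bar> * expectation (\<lambda>z. \<bar>fst z - snd z\<bar>)" by simp
  also have "\<dots> \<le> \<bar>t\<bar> * sqrt x" using E by (intro mult_left_mono) auto
  finally show ?thesis .
qed

text \<open>The infimum need not be attained, so the estimate for a single coupling is applied to almost
  optimal couplings.\<close>

lemma char_diff_le_wasserstein2:
  assumes W: "wasserstein2 \<mu> \<nu> \<le> ennreal w" and w: "w \<ge> 0"
  shows "norm (char \<mu> t - char \<nu> t) \<le> \<bar>t\<bar> * w"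
proof -
  let ?cost = "\<lambda>\<gamma>. \<integral>\<^sup>+ z. ennreal (\<bar>fst z - snd z\<bar>\<^sup>2) \<partial>\<gamma>"
  let ?c = "INF \<gamma>\<in>couplings \<mu> \<nu>. ?cost \<gamma>"
  have c: "?c \<noteq> \<infinity>" "sqrt (enn2real ?c) \<le> w"
    using W w unfolding wasserstein2_def Let_def by (auto split: if_splits simp: top_unique)
  have "?c = ennreal (enn2real ?c)"
    using c(1) by (simp only: ennreal_enn2real_if infinity_ennreal_def if_False)
  then have cw: "?c \<le> ennreal (w\<^sup>2)"
    by (rule order_trans[OF eq_refl ennreal_leI[OF sqrt_le_D[OF c(2)]]])
  have "norm (char \<mu> t - char \<nu> t) \<le> \<bar>t\<bar> * sqrt (w\<^sup>2 + 1 / real (Suc n))" for n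
  proof -
    have "?c < ennreal (w\<^sup>2 + 1 / real (Suc n))"
      by (rule le_less_trans[OF cw]) (auto intro!: ennreal_lessI add_nonneg_pos)
    then obtain \<gamma> where "\<gamma> \<in> couplings \<mu> \<nu>" "?cost \<gamma> < ennreal (w\<^sup>2 + 1 / real (Suc n))"
      unfolding INF_less_iff by blast
    then show ?thesis by (intro char_diff_le_coupling_cost[of \<gamma>]) auto
  qed
  moreover have "(\<lambda>n. \<bar>t\<bar> * sqrt (w\<^sup>2 + 1 / real (Suc n))) \<longlonglongrightarrow> \<bar>t\<bar> * sqrt (w\<^sup>2 + 0)"
    by (intro tendsto_intros LIMSEQ_Suc[OF lim_1_over_n])
  ultimately have "norm (char \<mu> t - char \<nu> t) \<le> \<bar>t\<bar> * sqrt (w\<^sup>2 + 0)" by (intro LIMSEQ_le_const) auto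
  then show ?thesis using w by simp
qed

text \<open>Characteristic functions converge pointwise by the preceding estimate, so L\'evy's continuity
  theorem applies.\<close>

lemma weak_conv_m_if_wasserstein2_tendsto_0:
  assumes "\<And>n. real_distribution (\<mu> n)" "real_distribution \<nu>"
    and W: "\<And>n. wasserstein2 (\<mu> n) \<nu> \<le> ennreal (w n)" and w: "\<And>n. w n \<ge> 0" "w \<longlonglongrightarrow> 0"
  shows "weak_conv_m \<mu> \<nu>"
proof (rule levy_continuity)
  fix t
  have "(\<lambda>n. char (\<mu> n) t - char \<nu> t) \<longlonglongrightarrow> 0"
  proof (rule tendsto_0_le[where K=1])
    show "(\<lambda>n. \<bar>t\<bar> * w n) \<longlonglongrightarrow> 0" using tendsto_mult_left[OF w(2), of "\<bar>t\<bar>"] by simp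
    show "\<forall>\<^sub>F n in sequentially. norm (char (\<mu> n) t - char \<nu> t) \<le> norm (\<bar>t\<bar> * w n) * 1"
      using char_diff_le_wasserstein2[OF W w(1)] w(1) by (intro always_eventually) (simp add: abs_mult)
  qed
  then show "(\<lambda>n. char (\<mu> n) t) \<longlonglongrightarrow> char \<nu> t" by (simp add: LIM_zero_iff)
qed fact+

section \<open>Distance to the target\<close>

lemma placed_square_sums:
  assumes "inj_on \<sigma> {..<q}"
  shows "(\<lambda>k. (placed q \<beta> \<sigma> k)\<^sup>2) sums (\<Sum>r<q. (\<beta> r)\<^sup>2)"
proof -
  have "(placed q \<beta> \<sigma> k)\<^sup>2 = (\<Sum>r<q. if k = \<sigma> r then (\<beta> r)\<^sup>2 else 0)" for k
  proof (cases "\<exists>r<q. k = \<sigma> r")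
    case True
    then obtain r where r: "r < q" "k = \<sigma> r" by blast
    have "(\<Sum>s<q. if k = \<sigma> s then g s else 0) = (\<Sum>s<q. if s = r then g s else 0)" for g :: "nat \<Rightarrow> real"
      using r assms by (intro sum.cong) (auto simp: inj_on_def)
    then have "(\<Sum>s<q. if k = \<sigma> s then g s else 0) = g r" for g :: "nat \<Rightarrow> real"
      using r by simp
    then show ?thesis unfolding placed_def by (simp add: of_bool_def if_distrib[of "\<lambda>x. x * _"] cong: if_cong)
  qed (auto simp: placed_def)
  moreover have "(\<lambda>k. \<Sum>r<q. if k = \<sigma> r then (\<beta> r)\<^sup>2 else 0) sums (\<Sum>r<q. (\<beta> r)\<^sup>2)"
    by (intro sums_sum sums_single)
  ultimately show ?thesis by simp
qed

lemma zero_ext_power_sums: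
  assumes "p \<ge> 1"
  shows "(\<lambda>k. zero_ext q \<beta> k ^ p) sums (\<Sum>r<q. \<beta> r ^ p)"
proof -
  have "(\<lambda>k. if k < q then \<beta> k ^ p else 0) sums (\<Sum>r\<in>{..<q}. \<beta> r ^ p)"
    using sums_If_finite_set[of "{..<q}" "\<lambda>k. \<beta> k ^ p"] by simp
  moreover have "zero_ext q \<beta> k ^ p = (if k < q then \<beta> k ^ p else 0)" for k
    using assms by (simp add: zero_ext_def)
  ultimately show ?thesis by simp
qed

lemma Delta_zero_ext: "Delta q \<beta> (zero_ext q \<beta>) = 0"
proof -
  have "(zero_ext q \<beta> k)\<^sup>2 * (\<Prod>r<q. (zero_ext q \<beta> k - \<beta> r)\<^sup>2) = 0" for k
    by (cases "k < q") (auto simp: zero_ext_def)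
  then have "(\<lambda>k. (zero_ext q \<beta> k)\<^sup>2 * (\<Prod>r<q. (zero_ext q \<beta> k - \<beta> r)\<^sup>2)) = (\<lambda>_. 0)" by (rule ext)
  then show ?thesis unfolding Delta_def by (simp only: suminf_zero)
qed

context std_normal_sequence
begin

lemma chaos2_fin_eq: "chaos2_fin N q \<beta> = chaos2 N (zero_ext q \<beta>)"
proof
  fix \<omega>
  have "(\<Sum>k. zero_ext q \<beta> k * ((N k \<omega>)\<^sup>2 - 1)) = (\<Sum>k<q. zero_ext q \<beta> k * ((N k \<omega>)\<^sup>2 - 1))"
    by (rule suminf_finite) (auto simp: zero_ext_def)
  then show "chaos2_fin N q \<beta> \<omega> = chaos2 N (zero_ext q \<beta>) \<omega>"
    by (simp add: chaos2_fin_def chaos2_def zero_ext_def)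
qed

lemma char_placed_sum:
  assumes inj: "inj_on \<sigma> {..<q}"
  shows "char (distr M borel (\<lambda>\<omega>. \<Sum>r<q. \<beta> r * ((N (\<sigma> r) \<omega>)\<^sup>2 - 1))) t =
    (\<Prod>r<q. char (distr (density lborel (\<lambda>x. ennreal (std_normal_density x))) borel (\<lambda>x. \<beta> r * (x\<^sup>2 - 1))) t)"
proof -
  have "indep_vars (\<lambda>r. PiM {\<sigma> r} (\<lambda>_. borel)) (\<lambda>r \<omega>. restrict (\<lambda>i. N i \<omega>) {\<sigma> r}) {..<q}"
    using inj by (intro indep_vars_restrict[OF indep]) (auto simp: disjoint_family_on_def inj_on_def)
  from indep_vars_compose2[OF this, of "\<lambda>r y. \<beta> r * ((y (\<sigma> r))\<^sup>2 - 1)" "\<lambda>_. borel"]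
  have "indep_vars (\<lambda>_. borel) (\<lambda>r \<omega>. \<beta> r * ((N (\<sigma> r) \<omega>)\<^sup>2 - 1)) {..<q}" by simp
  from char_distr_sum[OF this, of t]
  have "char (distr M borel (\<lambda>\<omega>. \<Sum>r<q. \<beta> r * ((N (\<sigma> r) \<omega>)\<^sup>2 - 1))) t =
      (\<Prod>r<q. char (distr M borel (\<lambda>\<omega>. \<beta> r * ((N (\<sigma> r) \<omega>)\<^sup>2 - 1))) t)" .
  moreover have "distr M borel (\<lambda>\<omega>. b * ((N k \<omega>)\<^sup>2 - 1)) =
      distr (density lborel (\<lambda>x. ennreal (std_normal_density x))) borel (\<lambda>x. b * (x\<^sup>2 - 1))" for b k
    unfolding distributed_distr_eq_density[OF normal[of k], symmetric]
    by (subst distr_distr) (auto simp: comp_def)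
  ultimately show ?thesis by simp
qed

text \<open>As the \<open>N k\<close> are exchangeable, the law does not depend on the positions of the coefficients. The
  characteristic function, a product of factors that do not involve the positions, shows this.\<close>

lemma distr_chaos2_placed:
  assumes inj: "inj_on \<sigma> {..<q}"
  shows "distr M borel (chaos2 N (placed q \<beta> \<sigma>)) = distr M borel (chaos2_fin N q \<beta>)"
proof (rule Levy_uniqueness)
  have "chaos2 N (placed q \<beta> \<sigma>) \<omega> = (\<Sum>r<q. \<beta> r * ((N (\<sigma> r) \<omega>)\<^sup>2 - 1))" for \<omega>
  proof -
    have "(\<lambda>k. \<Sum>r<q. if k = \<sigma> r then \<beta> r * ((N (\<sigma> r) \<omega>)\<^sup>2 - 1) else 0) sums (\<Sum>r<q. \<beta> r * ((N (\<sigma> r) \<omega>)\<^sup>2 - 1))"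
      by (intro sums_sum sums_single)
    moreover have "placed q \<beta> \<sigma> k * ((N k \<omega>)\<^sup>2 - 1) = (\<Sum>r<q. if k = \<sigma> r then \<beta> r * ((N (\<sigma> r) \<omega>)\<^sup>2 - 1) else 0)" for k
      unfolding placed_def sum_distrib_right by (intro sum.cong) auto
    ultimately show ?thesis by (simp add: chaos2_def sums_iff)
  qed
  then have "chaos2 N (placed q \<beta> \<sigma>) = (\<lambda>\<omega>. \<Sum>r<q. \<beta> r * ((N (\<sigma> r) \<omega>)\<^sup>2 - 1))" by blast
  then show "char (distr M borel (chaos2 N (placed q \<beta> \<sigma>))) = char (distr M borel (chaos2_fin N q \<beta>))"
    using char_placed_sum[OF inj, of \<beta>] char_placed_sum[of "\<lambda>r. r" q \<beta>] by (auto simp: chaos2_fin_def[abs_def])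
qed (auto simp: chaos2_fin_eq)

text \<open>The coupling: on the probability space of $F_n$, the target coefficients are attached to the
  positions chosen by \<open>\<sigma>\<close>, and the same normal variables are used for both sums.\<close>

lemma wasserstein2_chaos2_le:
  assumes inj: "inj_on \<sigma> {..<q}" and a: "summable (\<lambda>k. (a k)\<^sup>2)"
    and ab: "summable (\<lambda>k. (a k - placed q \<beta> \<sigma> k)\<^sup>2)"
  shows "wasserstein2 (distr M borel (chaos2 N a)) (distr M borel (chaos2_fin N q \<beta>)) \<le>
    ennreal (sqrt (2 * (\<Sum>k. (a k - placed q \<beta> \<sigma> k)\<^sup>2)))"
  unfolding distr_chaos2_placed[OF inj, symmetric]
  using chaos2_diff_L2_le[OF a sums_summable[OF placed_square_sums[OF inj]] ab]
  by (intro wasserstein2_le_coupled) (auto intro: suminf_nonneg ab prob_space_axioms)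

lemma wasserstein2_chaos2_le_const:
  assumes a: "(\<lambda>k. (a k)\<^sup>2) sums 1" and \<beta>: "(\<Sum>r<q. (\<beta> r)\<^sup>2) = 1"
  shows "wasserstein2 (distr M borel (chaos2 N a)) (distr M borel (chaos2_fin N q \<beta>)) \<le> ennreal (sqrt 8)"
proof -
  let ?b = "placed q \<beta> (\<lambda>r. r)"
  have b: "(\<lambda>k. (?b k)\<^sup>2) sums 1" using placed_square_sums[of "\<lambda>r. r" q \<beta>] \<beta> by (simp add: inj_on_def)
  have s: "(\<lambda>k. 2 * (a k)\<^sup>2 + 2 * (?b k)\<^sup>2) sums (2 * 1 + 2 * 1)"
    by (intro sums_add sums_mult a b)
  have le: "(a k - ?b k)\<^sup>2 \<le> 2 * (a k)\<^sup>2 + 2 * (?b k)\<^sup>2" for k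
    using zero_le_power2[of "a k + ?b k"] by (simp add: power2_sum power2_diff)
  have sm: "summable (\<lambda>k. (a k - ?b k)\<^sup>2)"
    using le by (intro summable_comparison_test[OF _ sums_summable[OF s]]) auto
  have "(\<Sum>k. (a k - ?b k)\<^sup>2) \<le> 4"
    using suminf_le[OF le sm sums_summable[OF s]] s by (simp add: sums_iff)
  then have "ennreal (sqrt (2 * (\<Sum>k. (a k - ?b k)\<^sup>2))) \<le> ennreal (sqrt 8)"
    by (intro ennreal_leI) simp
  then show ?thesis
    by (rule order_trans[rotated], intro wasserstein2_chaos2_le[OF _ sums_summable[OF a] sm]) (simp add: inj_on_def)
qed

text \<open>Cumulants are power sums up to the factor $2^{p-1} (p-1)!$, which is at least 1.\<close>

lemma power_sum_diff_le_cumulant_diff: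
  assumes a: "(\<lambda>k. (a k)\<^sup>2) sums 1" and \<beta>: "(\<Sum>r<q. (\<beta> r)\<^sup>2) = 1" and p: "p \<ge> 2"
  shows "\<bar>(\<Sum>k. a k ^ p) - (\<Sum>r<q. \<beta> r ^ p)\<bar> \<le>
    \<bar>cumulant p (distr M borel (chaos2 N a)) - cumulant p (distr M borel (chaos2_fin N q \<beta>))\<bar>"
proof -
  let ?f = "2 ^ (p - 1) * fact (p - 1) :: real"
  have z: "(\<lambda>k. (zero_ext q \<beta> k)\<^sup>2) sums 1" using zero_ext_power_sums[of 2 q \<beta>] \<beta> by simp
  have "cumulant p (distr M borel (chaos2 N a)) = ?f * (\<Sum>k. a k ^ p)"
    by (rule cumulant_chaos2[OF a p])
  moreover have "cumulant p (distr M borel (chaos2_fin N q \<beta>)) = ?f * (\<Sum>r<q. \<beta> r ^ p)"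
    unfolding chaos2_fin_eq cumulant_chaos2[OF z p]
    using zero_ext_power_sums[of p q \<beta>] p by (simp add: sums_iff)
  ultimately have "\<bar>cumulant p (distr M borel (chaos2 N a)) - cumulant p (distr M borel (chaos2_fin N q \<beta>))\<bar> =
      ?f * \<bar>(\<Sum>k. a k ^ p) - (\<Sum>r<q. \<beta> r ^ p)\<bar>"
    by (simp add: right_diff_distrib[symmetric] abs_mult)
  moreover have "1 * 1 \<le> ?f" by (intro mult_mono) (auto simp: fact_ge_1)
  ultimately show ?thesis using mult_right_mono[of 1 ?f "\<bar>(\<Sum>k. a k ^ p) - (\<Sum>r<q. \<beta> r ^ p)\<bar>"] by simp
qed

text \<open>Either each target coefficient is met exactly once, and the rearranged target is coupled to $F_n$
  at distance of order $\sqrt\Delta$; or some multiplicity is wrong, and then the trivial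
  bound $\sqrt 8$ is absorbed by a right-hand side that is bounded away from 0.\<close>

lemma wasserstein2_le_if_profile_gap:
  assumes "separated_target q \<beta> d" and a: "(\<lambda>k. (a k)\<^sup>2) sums 1"
    and \<eta>: "\<eta> > 0" and R: "sqrt (Delta q \<beta> a) \<le> R" and K: "K \<ge> 0"
    and gap: "\<exists>r<q. separated_target.multiplicity_near \<beta> d a r \<noteq> 1 \<Longrightarrow> \<eta> \<le> K * R"
  shows "wasserstein2 (distr M borel (chaos2 N a)) (distr M borel (chaos2_fin N q \<beta>)) \<le>
    ennreal ((sqrt 2 * (2 / d) ^ q + sqrt 8 * K / \<eta>) * R)"
proof -
  interpret separated_target q \<beta> d by fact
  have R0: "R \<ge> 0" using R real_sqrt_ge_zero[OF Delta_nonneg[OF a]] by linarith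
  show ?thesis
  proof (cases "\<exists>r<q. multiplicity_near a r \<noteq> 1")
    case True
    then have "1 \<le> K * R / \<eta>" using gap \<eta> by (simp add: field_simps)
    then have "sqrt 8 * 1 \<le> sqrt 8 * (K * R / \<eta>)" by (intro mult_left_mono) auto
    also have "\<dots> \<le> (sqrt 2 * (2 / d) ^ q + sqrt 8 * K / \<eta>) * R"
      using mult_nonneg_nonneg[of "sqrt 2 * (2 / d) ^ q" R] R0 d_pos by (simp add: distrib_right mult.assoc)
    finally show ?thesis
      using wasserstein2_chaos2_le_const[OF a sum_sq] by (auto intro: order_trans ennreal_leI)
  next
    case False
    then obtain \<sigma> where \<sigma>: "inj_on \<sigma> {..<q}" "(\<lambda>k. rounded (a k)) = placed q \<beta> \<sigma>"
      using rounded_eq_placed[of a] by blast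
    then have eq: "rounded (a k) = placed q \<beta> \<sigma> k" for k by metis
    have "wasserstein2 (distr M borel (chaos2 N a)) (distr M borel (chaos2_fin N q \<beta>)) \<le>
        ennreal (sqrt (2 * (\<Sum>k. (a k - placed q \<beta> \<sigma> k)\<^sup>2)))"
      using wasserstein2_chaos2_le[OF \<sigma>(1) sums_summable[OF a]] rounding_distance(1)[OF a] unfolding eq by blast
    also have "\<dots> \<le> ennreal (sqrt (2 * ((2 / d) ^ (2 * q) * Delta q \<beta> a)))"
      using rounding_distance(2)[OF a] unfolding eq by (intro ennreal_leI real_sqrt_le_mono mult_left_mono) auto
    also have "sqrt (2 * ((2 / d) ^ (2 * q) * Delta q \<beta> a)) = sqrt 2 * (2 / d) ^ q * sqrt (Delta q \<beta> a)"
      using d_pos by (simp add: real_sqrt_mult power_even_eq)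
    also have "\<dots> \<le> (sqrt 2 * (2 / d) ^ q) * R" using R d_pos by (intro mult_left_mono) auto
    also have "\<dots> \<le> (sqrt 2 * (2 / d) ^ q + sqrt 8 * K / \<eta>) * R"
      using R0 K \<eta> by (intro mult_right_mono) auto
    finally show ?thesis by (simp add: ennreal_leI)
  qed
qed

end

text \<open>The power sums of the defect of the multiplicities measure how wrong the profile is. They are
  small if $\Delta$ and the differences of the power sums are.\<close>

lemma (in separated_target) multiplicity_defect_le:
  assumes a: "(\<lambda>k. (a k)\<^sup>2) sums 1" and p: "p \<ge> 2"
  shows "\<bar>\<Sum>r<q. (real (multiplicity_near a r) - 1) * \<beta> r ^ p\<bar> \<le>
    3 * real p * (2 / d) ^ q * sqrt (Delta q \<beta> a) + \<bar>(\<Sum>k. a k ^ p) - (\<Sum>r<q. \<beta> r ^ p)\<bar>"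
proof -
  have "(\<Sum>r<q. (real (multiplicity_near a r) - 1) * \<beta> r ^ p) = (\<Sum>r<q. multiplicity_near a r * \<beta> r ^ p) - (\<Sum>r<q. \<beta> r ^ p)"
    by (simp add: left_diff_distrib sum_subtractf)
  then show ?thesis using power_sum_error(2)[OF a p] by linarith
qed

theorem corollary2p1:
  fixes q :: nat and \<beta> :: "nat \<Rightarrow> real"
  assumes "q \<ge> 1"
    and "\<And>r. r < q \<Longrightarrow> \<beta> r \<noteq> 0"
    and "inj_on \<beta> {..<q}"
    and "(\<Sum>r<q. (\<beta> r)\<^sup>2) = 1"
  shows "\<exists>C>0. \<forall>(M :: 'a measure) (N :: nat \<Rightarrow> 'a \<Rightarrow> real) (\<alpha> :: nat \<Rightarrow> nat \<Rightarrow> real).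
    prob_space M \<longrightarrow>
    prob_space.indep_vars M (\<lambda>_. borel) N UNIV \<longrightarrow>
    (\<forall>k. distributed M lborel (N k) (\<lambda>x. ennreal (std_normal_density x))) \<longrightarrow>
    (\<forall>n. (\<lambda>k. (\<alpha> n k)\<^sup>2) sums 1) \<longrightarrow>
    (let F = (\<lambda>n. distr M borel (chaos2 N (\<alpha> n)));
         F_inf = distr M borel (chaos2_fin N q \<beta>)
     in
      (\<forall>n. wasserstein2 (F n) F_inf \<le>
         ennreal (C * (sqrt (Delta q \<beta> (\<alpha> n)) +
           (\<Sum>r=2..q+1. \<bar>cumulant r (F n) - cumulant r F_inf\<bar>)))) \<and>
      (rat_span_dim ((\<lambda>r. (\<beta> r)\<^sup>2) ` {..<q}) = q \<longrightarrow>
         (\<forall>n. wasserstein2 (F n) F_inf \<le> ennreal (C * sqrt (Delta q \<beta> (\<alpha> n)))) \<and>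
         Delta q \<beta> (zero_ext q \<beta>) = 0 \<and>
         ((\<lambda>n. Delta q \<beta> (\<alpha> n)) \<longlonglongrightarrow> Delta q \<beta> (zero_ext q \<beta>) \<longrightarrow>
            weak_conv_m F F_inf)))"
proof -
  obtain d where "d > 0" "\<And>r. r < q \<Longrightarrow> d \<le> \<bar>\<beta> r\<bar>"
    "\<And>r s. r < q \<Longrightarrow> s < q \<Longrightarrow> r \<noteq> s \<Longrightarrow> d \<le> \<bar>\<beta> r - \<beta> s\<bar>"
    using separation_exists[OF assms(2,3)] by blast
  then have sep: "separated_target q \<beta> d" using assms(4) by unfold_locales
  then interpret separated_target q \<beta> d .
  define B where "B = nat \<lfloor>(2 / d)\<^sup>2\<rfloor>"
  define D where "D = (2 / d) ^ q"
  have D0: "D \<ge> 0" unfolding D_def using d_pos by simp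
  define \<Phi> where "\<Phi> p n = \<bar>\<Sum>r<q. (real (n r) - 1) * \<beta> r ^ p\<bar>" for p and n :: "nat \<Rightarrow> nat"
  have \<Phi>_cong: "\<Phi> p n = \<Phi> p n'" if "\<And>r. r < q \<Longrightarrow> n r = n' r" for p n n'
    unfolding \<Phi>_def using that by simp
  have "\<exists>\<eta>>0. \<forall>n. (\<forall>r<q. n r \<le> B) \<longrightarrow> (\<exists>r<q. n r \<noteq> 1) \<longrightarrow> \<eta> \<le> (\<Sum>p=2..q+1. \<Phi> p n)"
  proof (rule finite_profile_gap)
    fix n :: "nat \<Rightarrow> nat" assume "\<exists>r<q. n r \<noteq> 1"
    then obtain p where "p \<in> {2..q+1}" "(\<Sum>r<q. (real (n r) - 1) * \<beta> r ^ p) \<noteq> 0"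
      using vandermonde_weights_zero[OF assms(2,3), of "\<lambda>r. real (n r) - 1"] by fastforce
    then show "(\<Sum>p=2..q+1. \<Phi> p n) > 0" unfolding \<Phi>_def by (intro sum_pos2[of _ p]) auto
  qed (intro sum.cong refl \<Phi>_cong, blast)
  then obtain \<eta> where \<eta>: "\<eta> > 0"
    "\<And>n. (\<And>r. r < q \<Longrightarrow> n r \<le> B) \<Longrightarrow> \<exists>r<q. n r \<noteq> 1 \<Longrightarrow> \<eta> \<le> (\<Sum>p=2..q+1. \<Phi> p n)" by blast
  let ?indep = "rat_span_dim ((\<lambda>r. (\<beta> r)\<^sup>2) ` {..<q}) = q"
  have "\<exists>\<eta>>0. \<forall>n. (\<forall>r<q. n r \<le> B) \<longrightarrow> (\<exists>r<q. n r \<noteq> 1) \<longrightarrow> \<eta> \<le> \<Phi> 2 n" if ?indep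
  proof (rule finite_profile_gap)
    fix n :: "nat \<Rightarrow> nat" assume n: "\<exists>r<q. n r \<noteq> 1"
    have "(\<Sum>r<q. (real (n r) - 1) * (\<beta> r)\<^sup>2) \<noteq> 0"
    proof
      assume "(\<Sum>r<q. (real (n r) - 1) * (\<beta> r)\<^sup>2) = 0"
      then have "(\<Sum>r<q. real_of_rat (of_nat (n r) - 1) * (\<beta> r)\<^sup>2) = 0" by (simp add: of_rat_diff)
      from rational_weights_zero[OF that this] n show False by auto
    qed
    then show "\<Phi> 2 n > 0" unfolding \<Phi>_def by simp
  qed (rule \<Phi>_cong)
  \<comment> \<open>If the squares are dependent over the rationals, the witness is 1.\<close>
  then obtain \<eta>' where \<eta>': "\<eta>' > 0"
    "\<And>n. ?indep \<Longrightarrow> (\<And>r. r < q \<Longrightarrow> n r \<le> B) \<Longrightarrow> \<exists>r<q. n r \<noteq> 1 \<Longrightarrow> \<eta>' \<le> \<Phi> 2 n"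
    by (metis zero_less_one)
  define K where "K = 1 + (\<Sum>p=2..q+1. 3 * real p * D)"
  have K0: "K \<ge> 1" unfolding K_def using D0 by (simp add: sum_nonneg)
  \<comment> \<open>The first summand serves the right profile, the other two the wrong profiles in the two parts.
    In the second part the exponent is 2, whence the 6 as the value of \<open>3 * p\<close>.\<close>
  define C where "C = sqrt 2 * D + sqrt 8 * K / \<eta> + sqrt 8 * (6 * D) / \<eta>'"
  have "0 \<le> sqrt 2 * D" "0 < sqrt 8 * K / \<eta>" "0 \<le> sqrt 8 * (6 * D) / \<eta>'"
    using D0 K0 \<eta>(1) \<eta>'(1) by auto
  then have Ca: "sqrt 2 * D + sqrt 8 * K / \<eta> \<le> C" and Cb: "sqrt 2 * D + sqrt 8 * (6 * D) / \<eta>' \<le> C" and C0: "C > 0"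
    unfolding C_def by linarith+
  show ?thesis
  proof (intro exI[of _ C] conjI C0 allI impI)
    fix M :: "'a measure" and N :: "nat \<Rightarrow> 'a \<Rightarrow> real" and \<alpha> :: "nat \<Rightarrow> nat \<Rightarrow> real"
    assume M: "prob_space M" "prob_space.indep_vars M (\<lambda>_. borel) N UNIV"
      "\<forall>k. distributed M lborel (N k) (\<lambda>x. ennreal (std_normal_density x))"
      and \<alpha>: "\<forall>n. (\<lambda>k. (\<alpha> n k)\<^sup>2) sums 1"
    interpret prob_space M by fact
    interpret std_normal_sequence M N using M by unfold_locales auto
    have a: "(\<lambda>k. (\<alpha> n k)\<^sup>2) sums 1" for n using \<alpha> by blast
    have mult: "multiplicity_near (\<alpha> n) r \<le> B" if "r < q" for n r
      unfolding B_def using that by (rule multiplicity_near_le[OF a])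
    define F where "F n = distr M borel (chaos2 N (\<alpha> n))" for n
    define F_inf where "F_inf = distr M borel (chaos2_fin N q \<beta>)"
    have \<Delta>0: "Delta q \<beta> (\<alpha> n) \<ge> 0" for n by (rule Delta_nonneg[OF a])
    have part_a: "wasserstein2 (F n) F_inf \<le> ennreal (C * (sqrt (Delta q \<beta> (\<alpha> n)) +
        (\<Sum>r=2..q+1. \<bar>cumulant r (F n) - cumulant r F_inf\<bar>)))" for n
    proof -
      let ?\<kappa> = "\<lambda>p. \<bar>cumulant p (F n) - cumulant p F_inf\<bar>"
      let ?s = "sqrt (Delta q \<beta> (\<alpha> n))"
      let ?R = "?s + (\<Sum>p=2..q+1. ?\<kappa> p)"
      have "wasserstein2 (F n) F_inf \<le> ennreal ((sqrt 2 * D + sqrt 8 * K / \<eta>) * ?R)"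
      proof (rule wasserstein2_le_if_profile_gap[OF sep a[of n] \<eta>(1), folded F_def F_inf_def D_def])
        assume "\<exists>r<q. multiplicity_near (\<alpha> n) r \<noteq> 1"
        then have "\<eta> \<le> (\<Sum>p=2..q+1. \<Phi> p (multiplicity_near (\<alpha> n)))" by (intro \<eta>(2) mult)
        also have "\<dots> \<le> (\<Sum>p=2..q+1. 3 * real p * D * ?s + ?\<kappa> p)"
        proof (rule sum_mono)
          fix p assume "p \<in> {2..q+1}"
          then have p: "p \<ge> 2" by simp
          show "\<Phi> p (multiplicity_near (\<alpha> n)) \<le> 3 * real p * D * ?s + ?\<kappa> p"
            using multiplicity_defect_le[OF a p, of n] power_sum_diff_le_cumulant_diff[OF a sum_sq p, of n]
            unfolding \<Phi>_def D_def F_def F_inf_def by linarith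
        qed
        also have "\<dots> = (\<Sum>p=2..q+1. 3 * real p * D) * ?s + (\<Sum>p=2..q+1. ?\<kappa> p)"
          unfolding sum.distrib sum_distrib_right ..
        also have "\<dots> \<le> K * ?s + K * (\<Sum>p=2..q+1. ?\<kappa> p)"
        proof (rule add_mono)
          show "(\<Sum>p=2..q+1. 3 * real p * D) * ?s \<le> K * ?s"
            unfolding K_def using \<Delta>0 by (intro mult_right_mono) auto
          show "(\<Sum>p=2..q+1. ?\<kappa> p) \<le> K * (\<Sum>p=2..q+1. ?\<kappa> p)"
            using mult_right_mono[OF K0, of "\<Sum>p=2..q+1. ?\<kappa> p"] by (simp add: sum_nonneg)
        qed
        finally show "\<eta> \<le> K * ?R" by (simp add: distrib_left)
      qed (use K0 in \<open>auto intro!: sum_nonneg\<close>)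
      also have "\<dots> \<le> ennreal (C * ?R)"
        using \<Delta>0 by (intro ennreal_leI mult_right_mono Ca add_nonneg_nonneg sum_nonneg) auto
      finally show ?thesis .
    qed
    have part_b: "wasserstein2 (F n) F_inf \<le> ennreal (C * sqrt (Delta q \<beta> (\<alpha> n)))" if ?indep for n
    proof -
      let ?s = "sqrt (Delta q \<beta> (\<alpha> n))"
      have "wasserstein2 (F n) F_inf \<le> ennreal ((sqrt 2 * D + sqrt 8 * (6 * D) / \<eta>') * ?s)"
      proof (rule wasserstein2_le_if_profile_gap[OF sep a[of n] \<eta>'(1), folded F_def F_inf_def D_def])
        assume "\<exists>r<q. multiplicity_near (\<alpha> n) r \<noteq> 1"
        then have "\<eta>' \<le> \<Phi> 2 (multiplicity_near (\<alpha> n))" by (intro \<eta>'(2) mult that)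
        also have "\<dots> \<le> 3 * real 2 * D * ?s + \<bar>(\<Sum>k. (\<alpha> n k)\<^sup>2) - (\<Sum>r<q. (\<beta> r)\<^sup>2)\<bar>"
          using multiplicity_defect_le[OF a order_refl, of n] unfolding \<Phi>_def D_def .
        also have "\<dots> = 6 * D * ?s" using a[of n] sum_sq by (simp add: sums_iff)
        finally show "\<eta>' \<le> 6 * D * ?s" .
      qed (use D0 in auto)
      also have "\<dots> \<le> ennreal (C * ?s)"
        using \<Delta>0 by (intro ennreal_leI mult_right_mono Cb) auto
      finally show ?thesis .
    qed
    have conv: "weak_conv_m F F_inf" if ind: ?indep and lim: "(\<lambda>n. Delta q \<beta> (\<alpha> n)) \<longlonglongrightarrow> Delta q \<beta> (zero_ext q \<beta>)"
    proof (rule weak_conv_m_if_wasserstein2_tendsto_0[OF _ _ part_b[OF ind]])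
      show "(\<lambda>n. C * sqrt (Delta q \<beta> (\<alpha> n))) \<longlonglongrightarrow> 0"
        using tendsto_mult_left[OF tendsto_real_sqrt[OF lim], of C] by (simp add: Delta_zero_ext)
    qed (use \<Delta>0 C0 in \<open>auto simp: F_def F_inf_def chaos2_fin_eq\<close>)
    show "let F = (\<lambda>n. distr M borel (chaos2 N (\<alpha> n)));
         F_inf = distr M borel (chaos2_fin N q \<beta>)
     in
      (\<forall>n. wasserstein2 (F n) F_inf \<le>
         ennreal (C * (sqrt (Delta q \<beta> (\<alpha> n)) +
           (\<Sum>r=2..q+1. \<bar>cumulant r (F n) - cumulant r F_inf\<bar>)))) \<and>
      (rat_span_dim ((\<lambda>r. (\<beta> r)\<^sup>2) ` {..<q}) = q \<longrightarrow>
         (\<forall>n. wasserstein2 (F n) F_inf \<le> ennreal (C * sqrt (Delta q \<beta> (\<alpha> n)))) \<and>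
         Delta q \<beta> (zero_ext q \<beta>) = 0 \<and>
         ((\<lambda>n. Delta q \<beta> (\<alpha> n)) \<longlonglongrightarrow> Delta q \<beta> (zero_ext q \<beta>) \<longrightarrow>
            weak_conv_m F F_inf))"
      unfolding Let_def F_def[symmetric, abs_def] F_inf_def[symmetric]
      using part_a part_b conv Delta_zero_ext unfolding F_def[abs_def] by blast
  qed
qed

end
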